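(* Let $(k_n)_{n\ge1}$ be a sequence of positive integers with $k_n\le n$ and $$\limsup_{n\to\infty}\frac{k_n}{n^{4/9}}=\infty .$$ Then the weak law of large numbers fails for $Z_{n,k_n}$; that is, it is not true that $\dfrac{Z_{n,k_n}}{E Z_{n,k_n}}\to 1$ in probability as $n\to\infty$.
   Context: $S_n$ denotes the symmetric group of permutations of $\{1,\dots,n\}$, equipped with the uniform probability measure $U_n$; $P$ and $E$ denote probability and expectation under $U_n$. For $\sigma\in S_n$, an increasing subsequence of length $k$ is a set $\{x_1<\dots<x_k\}\subset\{1,\dots,n\}$ of values that appear in $\sigma$ (in one-line notation $\sigma(1)\sigma(2)\cdots\sigma(n)$) in increasing order from left to right, i.e. $\sigma^{-1}(x_1)<\dots<\sigma^{-1}(x_k)$. $Z_{n,k}(\sigma)$ is the number of increasing subsequences of length $k$ in $\sigma$. One has $EZ_{n,k}=\binom{n}{k}/k!$. *)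

theory Defs
  imports "HOL-Analysis.Analysis" "HOL-Combinatorics.Permutations"
begin

definition Sym :: "nat \<Rightarrow> (nat \<Rightarrow> nat) set" where
  "Sym n = {\<sigma>. \<sigma> permutes {1..n}}"

text \<open>A set of values is an increasing subsequence of \<sigma> if its values appear
  in increasing order from left to right, i.e. positions inv \<sigma> are increasing.\<close>
definition incr_subseq :: "(nat \<Rightarrow> nat) \<Rightarrow> nat set \<Rightarrow> bool" where
  "incr_subseq \<sigma> A \<longleftrightarrow> (\<forall>x\<in>A. \<forall>y\<in>A. x < y \<longrightarrow> inv \<sigma> x < inv \<sigma> y)"

definition Z :: "nat \<Rightarrow> nat \<Rightarrow> (nat \<Rightarrow> nat) \<Rightarrow> nat" where
  "Z n k \<sigma> = card {A. A \<subseteq> {1..n} \<and> card A = k \<and> incr_subseq \<sigma> A}"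

definition probU :: "nat \<Rightarrow> ((nat \<Rightarrow> nat) \<Rightarrow> bool) \<Rightarrow> real" where
  "probU n P = real (card {\<sigma>\<in>Sym n. P \<sigma>}) / real (card (Sym n))"

definition expU :: "nat \<Rightarrow> ((nat \<Rightarrow> nat) \<Rightarrow> real) \<Rightarrow> real" where
  "expU n f = (\<Sum>\<sigma>\<in>Sym n. f \<sigma>) / real (card (Sym n))"

end

theory Submission
  imports Defs
begin

text \<open>
  Relative to the uniform measure, \<open>Z / E Z\<close> is the density of the planted measure, in which the
  increasing bijection between two uniformly random \<open>k\<close>-subsets of \<open>{1..n}\<close> is extended to a uniformly
  random permutation. A density close to 1 in probability makes the two measures close, so it
  suffices to find an event that separates them. Cut \<open>{1..n}\<close> into blocks of length \<open>w\<close> and let \<open>X\<close> count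
  the \<open>i\<close> for which \<open>i\<close> and \<open>\<sigma> i\<close> lie in the same block. Under the uniform measure \<open>X\<close> has variance
  at most \<open>3 * w\<close>. A planted point leaves its block only if it crosses one of the \<open>n / w\<close> block
  boundaries, and about \<open>sqrt k\<close> planted points cross a given boundary; hence for \<open>w\<close> of order
  \<open>n / sqrt k\<close> most of the \<open>k\<close> planted points stay on the diagonal and \<open>X\<close> grows by at least \<open>k / 2\<close>.
  The event \<open>X \<ge> E X + k / 2\<close> separates the measures once \<open>w\<close> is small compared with \<open>k\<^sup>2\<close>,
  which already holds when \<open>k\<close> is large compared with \<open>n powr (2/5)\<close>. If \<open>k > n / 2\<close>, then \<open>E Z \<le> 1/2\<close>
  and \<open>Z\<close> vanishes with probability at least \<open>1/2\<close>.
\<close>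

section \<open>Permutations hitting a prescribed set of pairs\<close>

text \<open>Composing with \<open>inv \<tau>\<close> turns agreement with \<open>\<tau>\<close> on
  \<open>S\<close> into fixing \<open>S\<close> pointwise, so these permutations form a left coset
  of the group of permutations of \<open>N - S\<close>.\<close>

lemma permutes_agreeing_on:
  assumes "\<tau> permutes N" "S \<subseteq> N"
  shows "{\<sigma>. \<sigma> permutes N \<and> (\<forall>i\<in>S. \<sigma> i = \<tau> i)} = (\<lambda>\<rho>. \<tau> \<circ> \<rho>) ` {\<rho>. \<rho> permutes N - S}"
proof (intro subset_antisym subsetI)
  fix \<sigma> assume "\<sigma> \<in> {\<sigma>. \<sigma> permutes N \<and> (\<forall>i\<in>S. \<sigma> i = \<tau> i)}"
  then have s: "\<sigma> permutes N" "\<And>i. i \<in> S \<Longrightarrow> \<sigma> i = \<tau> i" by auto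
  have "inv \<tau> \<circ> \<sigma> permutes N - S"
  proof (rule permutes_superset)
    show "inv \<tau> \<circ> \<sigma> permutes N"
      by (intro permutes_compose s permutes_inv assms)
    show "(inv \<tau> \<circ> \<sigma>) x = x" if "x \<in> N - (N - S)" for x
      using that s(2)[of x] assms by (auto simp: permutes_inverses)
  qed
  moreover have "\<sigma> = \<tau> \<circ> (inv \<tau> \<circ> \<sigma>)"
    using assms by (auto simp: fun_eq_iff permutes_inverses)
  ultimately show "\<sigma> \<in> (\<lambda>\<rho>. \<tau> \<circ> \<rho>) ` {\<rho>. \<rho> permutes N - S}" by blast
next
  fix \<sigma> assume "\<sigma> \<in> (\<lambda>\<rho>. \<tau> \<circ> \<rho>) ` {\<rho>. \<rho> permutes N - S}"
  then obtain \<rho> where r: "\<rho> permutes N - S" "\<sigma> = \<tau> \<circ> \<rho>" by auto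
  have "\<rho> permutes N" by (rule permutes_subset[OF r(1)]) auto
  then have "\<sigma> permutes N" using r assms by (auto intro: permutes_compose)
  moreover have "\<sigma> i = \<tau> i" if "i \<in> S" for i
    using r that permutes_not_in[OF r(1), of i] by auto
  ultimately show "\<sigma> \<in> {\<sigma>. \<sigma> permutes N \<and> (\<forall>i\<in>S. \<sigma> i = \<tau> i)}" by auto
qed

lemma inj_on_compose_permutes:
  assumes "\<tau> permutes N"
  shows "inj_on (\<lambda>\<rho>. \<tau> \<circ> \<rho>) X"
  by (rule inj_onI) (metis assms comp_assoc id_comp permutes_inv_o(2))

text \<open>The complements of \<open>S\<close> and of its image under \<open>p\<close> have the
  same size, so any bijection between them completes \<open>p\<close>.\<close>

lemma permutes_extension_exists:
  assumes "finite N" "S \<subseteq> N" "inj_on p S" "p ` S \<subseteq> N"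
  obtains \<tau> where "\<tau> permutes N" "\<And>i. i \<in> S \<Longrightarrow> \<tau> i = p i"
proof -
  have fS: "finite S" using assms finite_subset by blast
  have "card (N - S) = card (N - p ` S)"
    using assms fS by (simp add: card_Diff_subset card_image)
  then obtain f where f: "bij_betw f (N - S) (N - p ` S)"
    using finite_same_card_bij[of "N - S" "N - p ` S"] assms by auto
  define \<tau> where "\<tau> x = (if x \<in> S then p x else if x \<in> N then f x else x)" for x
  have 1: "bij_betw \<tau> S (p ` S)"
    using assms(3) by (auto simp: bij_betw_def \<tau>_def inj_on_def)
  have "bij_betw \<tau> (N - S) (N - p ` S) \<longleftrightarrow> bij_betw f (N - S) (N - p ` S)"
    by (rule bij_betw_cong) (auto simp: \<tau>_def)
  with f have 2: "bij_betw \<tau> (N - S) (N - p ` S)" by simp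
  have "bij_betw \<tau> (S \<union> (N - S)) (p ` S \<union> (N - p ` S))"
    by (rule bij_betw_combine[OF 1 2]) auto
  then have "bij_betw \<tau> N N" using assms by (simp add: Un_absorb1)
  then have "\<tau> permutes N"
    by (rule bij_imp_permutes) (use assms in \<open>auto simp: \<tau>_def\<close>)
  then show ?thesis by (rule that) (auto simp: \<tau>_def)
qed

lemma card_permutes_extending:
  assumes "finite N" "S \<subseteq> N" "inj_on p S" "p ` S \<subseteq> N"
  shows "card {\<sigma>. \<sigma> permutes N \<and> (\<forall>i\<in>S. \<sigma> i = p i)} = fact (card N - card S)"
proof -
  obtain \<tau> where t: "\<tau> permutes N" "\<And>i. i \<in> S \<Longrightarrow> \<tau> i = p i"
    using permutes_extension_exists[OF assms] by blast
  have "{\<sigma>. \<sigma> permutes N \<and> (\<forall>i\<in>S. \<sigma> i = p i)} = {\<sigma>. \<sigma> permutes N \<and> (\<forall>i\<in>S. \<sigma> i = \<tau> i)}"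
    using t(2) by auto
  also have "\<dots> = (\<lambda>\<rho>. \<tau> \<circ> \<rho>) ` {\<rho>. \<rho> permutes N - S}"
    by (rule permutes_agreeing_on[OF t(1) assms(2)])
  also have "card \<dots> = card {\<rho>. \<rho> permutes N - S}"
    by (rule card_image[OF inj_on_compose_permutes[OF t(1)]])
  also have "\<dots> = fact (card N - card S)"
    using assms by (subst card_permutations[OF refl]) (auto simp: card_Diff_subset finite_subset)
  finally show ?thesis .
qed

text \<open>Two prescribed values coincide, conflict or are independent of each other. A conflict
  leaves no permutation at all, so an upper bound covers all cases, and the second moment needs no
  more.\<close>

lemma card_permutes_pair:
  assumes "finite T" "i \<in> T" "j \<in> T" "i' \<in> T" "j' \<in> T"
  shows "real (card {\<rho>. \<rho> permutes T \<and> \<rho> i = j \<and> \<rho> i' = j'})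
     \<le> (if (i,j) = (i',j') then fact (card T - 1) else fact (card T - 2))"
proof (cases "i = i' \<longleftrightarrow> j = j'")
  case True
  define p where "p x = (if x = i then j else j')" for x
  have "{\<rho>. \<rho> permutes T \<and> \<rho> i = j \<and> \<rho> i' = j'} = {\<rho>. \<rho> permutes T \<and> (\<forall>x\<in>{i,i'}. \<rho> x = p x)}"
    using True by (auto simp: p_def)
  also have "card \<dots> = fact (card T - card {i,i'})"
    by (rule card_permutes_extending) (use assms True in \<open>auto simp: p_def\<close>)
  finally have "card {\<rho>. \<rho> permutes T \<and> \<rho> i = j \<and> \<rho> i' = j'} = fact (card T - card {i,i'})" .
  then show ?thesis using True by (cases "i = i'") (auto simp: numeral_2_eq_2)
next
  case False
  have "{\<rho>. \<rho> permutes T \<and> \<rho> i = j \<and> \<rho> i' = j'} = {}"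
    using False permutes_inj[of _ T] by (auto simp: inj_def)
  then show ?thesis by (simp only: card.empty) simp
qed

lemma card_permutes_single:
  assumes "finite T" "i \<in> T" "j \<in> T"
  shows "card {\<rho>. \<rho> permutes T \<and> \<rho> i = j} = fact (card T - 1)"
  using card_permutes_extending[of T "{i}" "\<lambda>_. j"] assms by simp

section \<open>Second moments and Chebyshev's inequality for random permutations\<close>

lemma sum_square_diff:
  fixes f :: "'a \<Rightarrow> real"
  shows "(\<Sum>x\<in>P. (f x - c)\<^sup>2) = (\<Sum>x\<in>P. (f x)\<^sup>2) - 2 * c * (\<Sum>x\<in>P. f x) + c\<^sup>2 * card P"
  unfolding power2_diff sum.distrib sum_subtractf by (simp add: sum_distrib_left sum_distrib_right mult_ac)

text \<open>The count is a sum of indicators of \<open>\<rho> i = j\<close> over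
  \<open>(i, j) \<in> D\<close>, so its moments come from permutations with one or two prescribed
  values. The shape of \<open>D\<close> is left free: the bound serves both the uniform permutation
  and the random completion of a planted one.\<close>

lemma permutation_count_variance:
  fixes T :: "'a set" and d :: real
  assumes T: "finite T" "card T \<ge> 2" and D: "D \<subseteq> T \<times> T"
    and d: "real (card D) \<le> card T * d" "d \<le> card T"
  shows "(\<Sum>\<rho> | \<rho> permutes T. (real (card {i\<in>T. (i, \<rho> i) \<in> D}) - card D / card T)\<^sup>2)
     \<le> fact (card T) * (3 * d)"
proof -
  define P where "P = {\<rho>. \<rho> permutes T}"
  define X where "X \<rho> = real (card {i\<in>T. (i, \<rho> i) \<in> D})" for \<rho>
  define t where "t = real (card T)"
  define m where "m = real (card D)"
  have fP: "finite P" unfolding P_def by (rule finite_permutations[OF T(1)])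
  have fD: "finite D" using D T finite_subset by blast
  have cP: "real (card P) = fact (card T)"
    unfolding P_def by (subst card_permutations[OF refl T(1)]) simp
  have X: "X \<rho> = (\<Sum>e\<in>D. of_bool (\<rho> (fst e) = snd e))" for \<rho>
  proof -
    have "{e\<in>D. \<rho> (fst e) = snd e} = (\<lambda>i. (i, \<rho> i)) ` {i\<in>T. (i, \<rho> i) \<in> D}"
      using D by force
    then have "card {e\<in>D. \<rho> (fst e) = snd e} = card {i\<in>T. (i, \<rho> i) \<in> D}"
      by (simp add: card_image inj_on_def)
    then show ?thesis using fD by (simp add: X_def Int_def)
  qed
  have t2: "t \<ge> 2" using T by (simp add: t_def)
  have f1: "fact (card T) = t * (fact (card T - 1) :: real)"
    using T by (simp add: t_def fact_reduce)
  have f2: "fact (card T - 1) = (t - 1) * (fact (card T - 2) :: real)"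
    using T fact_reduce[of "card T - 1", where 'a=real] by (simp add: t_def of_nat_diff numeral_2_eq_2)
  have S1: "(\<Sum>\<rho>\<in>P. X \<rho>) = m * fact (card T - 1)"
  proof -
    have "(\<Sum>\<rho>\<in>P. X \<rho>) = (\<Sum>e\<in>D. \<Sum>\<rho>\<in>P. of_bool (\<rho> (fst e) = snd e))"
      unfolding X by (rule sum.swap)
    also have "\<dots> = (\<Sum>e\<in>D. fact (card T - 1))"
    proof (rule sum.cong[OF refl])
      fix e assume "e \<in> D"
      then have "card {\<rho>. \<rho> permutes T \<and> \<rho> (fst e) = snd e} = fact (card T - 1)"
        using D T by (intro card_permutes_single) auto
      moreover have "P \<inter> {\<rho>. \<rho> (fst e) = snd e} = {\<rho>. \<rho> permutes T \<and> \<rho> (fst e) = snd e}"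
        by (auto simp: P_def)
      ultimately show "(\<Sum>\<rho>\<in>P. of_bool (\<rho> (fst e) = snd e)) = (fact (card T - 1) :: real)"
        using fP by simp
    qed
    finally show ?thesis by (simp add: m_def)
  qed
  have S2: "(\<Sum>\<rho>\<in>P. (X \<rho>)\<^sup>2) \<le> m * fact (card T - 1) + m\<^sup>2 * fact (card T - 2)"
  proof -
    have "(\<Sum>\<rho>\<in>P. (X \<rho>)\<^sup>2) = (\<Sum>\<rho>\<in>P. \<Sum>e\<in>D. \<Sum>e'\<in>D. of_bool (\<rho> (fst e) = snd e \<and> \<rho> (fst e') = snd e'))"
      unfolding X power2_eq_square sum_product by (simp add: of_bool_conj)
    also have "\<dots> = (\<Sum>e\<in>D. \<Sum>e'\<in>D. \<Sum>\<rho>\<in>P. of_bool (\<rho> (fst e) = snd e \<and> \<rho> (fst e') = snd e'))"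
      by (subst sum.swap) (intro sum.cong refl sum.swap)
    also have "\<dots> \<le> (\<Sum>e\<in>D. \<Sum>e'\<in>D. of_bool (e = e') * fact (card T - 1) + fact (card T - 2))"
    proof (intro sum_mono)
      fix e e' assume e: "e \<in> D" "e' \<in> D"
      have "P \<inter> {\<rho>. \<rho> (fst e) = snd e \<and> \<rho> (fst e') = snd e'}
        = {\<rho>. \<rho> permutes T \<and> \<rho> (fst e) = snd e \<and> \<rho> (fst e') = snd e'}"
        by (auto simp: P_def)
      then have "(\<Sum>\<rho>\<in>P. of_bool (\<rho> (fst e) = snd e \<and> \<rho> (fst e') = snd e'))
         = real (card {\<rho>. \<rho> permutes T \<and> \<rho> (fst e) = snd e \<and> \<rho> (fst e') = snd e'})"
        using fP by simp
      also have "\<dots> \<le> (if (fst e, snd e) = (fst e', snd e') then fact (card T - 1) else fact (card T - 2))"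
        by (rule card_permutes_pair) (use e D T in auto)
      also have "\<dots> \<le> of_bool (e = e') * fact (card T - 1) + fact (card T - 2)"
        by auto
      finally show "(\<Sum>\<rho>\<in>P. of_bool (\<rho> (fst e) = snd e \<and> \<rho> (fst e') = snd e'))
        \<le> of_bool (e = e') * fact (card T - 1) + (fact (card T - 2) :: real)" .
    qed
    also have "\<dots> = m * fact (card T - 1) + m\<^sup>2 * fact (card T - 2)"
    proof -
      have "(\<Sum>e'\<in>D. of_bool (e = e') * fact (card T - 1) + fact (card T - 2))
          = fact (card T - 1) + m * (fact (card T - 2) :: real)" if "e \<in> D" for e
        using fD that by (simp add: sum.distrib m_def flip: sum_distrib_right)
      then have "(\<Sum>e\<in>D. \<Sum>e'\<in>D. of_bool (e = e') * fact (card T - 1) + fact (card T - 2))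
          = (\<Sum>e\<in>D. fact (card T - 1) + m * (fact (card T - 2) :: real))"
        by (rule sum.cong[OF refl])
      then show ?thesis by (simp add: m_def algebra_simps power2_eq_square)
    qed
    finally show ?thesis .
  qed
  have m: "m / t \<le> d" "0 \<le> m" "0 \<le> m / t"
    using d t2 by (auto simp: m_def t_def field_simps)
  have d0: "0 \<le> d" using m by linarith
  have "(\<Sum>\<rho>\<in>P. (X \<rho> - m / t)\<^sup>2) = (\<Sum>\<rho>\<in>P. (X \<rho>)\<^sup>2) - 2 * (m / t) * (\<Sum>\<rho>\<in>P. X \<rho>) + (m / t)\<^sup>2 * fact (card T)"
    by (simp add: sum_square_diff cP)
  also have "\<dots> \<le> m * fact (card T - 1) + m\<^sup>2 * fact (card T - 2)
     - 2 * (m / t) * (m * fact (card T - 1)) + (m / t)\<^sup>2 * fact (card T)"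
    using S1 S2 by simp
  \<comment> \<open>After division by the factorial, the quadratic terms combine through m^2 / (t (t
    - 1)) - (m / t)^2 = (m / t)^2 / (t - 1).\<close>
  also have "\<dots> = fact (card T) * (m / t + (m / t)\<^sup>2 / (t - 1))"
    using t2 unfolding f1 f2 by (simp add: divide_simps) (simp add: power2_eq_square algebra_simps)
  also have "\<dots> \<le> fact (card T) * (3 * d)"
  proof (rule mult_left_mono)
    \<comment> \<open>One factor \<open>m / t\<close> is bounded by \<open>d\<close>, the other by
      \<open>t\<close>, which is at least \<open>d\<close>.\<close>
    have "(m / t)\<^sup>2 \<le> d * t"
      using m d t2 d0 unfolding power2_eq_square
      by (intro mult_mono) (auto simp: t_def)
    also have "\<dots> \<le> d * (2 * (t - 1))" using t2 d0 by (intro mult_left_mono) auto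
    finally have "(m / t)\<^sup>2 / (t - 1) \<le> 2 * d" using t2 by (simp add: field_simps)
    then show "m / t + (m / t)\<^sup>2 / (t - 1) \<le> 3 * d" using m by simp
  qed simp
  finally show ?thesis by (simp add: X_def P_def m_def t_def)
qed

text \<open>Chebyshev's inequality in counting form.\<close>

lemma card_deviation_le:
  fixes f :: "'a \<Rightarrow> real"
  assumes "finite P" "a > 0" "(\<Sum>x\<in>P. (f x - c)\<^sup>2) \<le> v"
  shows "real (card {x\<in>P. a \<le> \<bar>f x - c\<bar>}) \<le> v / a\<^sup>2"
proof -
  have "real (card {x\<in>P. a \<le> \<bar>f x - c\<bar>}) * a\<^sup>2 = (\<Sum>x\<in>{x\<in>P. a \<le> \<bar>f x - c\<bar>}. a\<^sup>2)" by simp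
  also have "\<dots> \<le> (\<Sum>x\<in>{x\<in>P. a \<le> \<bar>f x - c\<bar>}. (f x - c)\<^sup>2)"
    using assms(2) by (intro sum_mono) (simp add: abs_le_square_iff[symmetric])
  also have "\<dots> \<le> (\<Sum>x\<in>P. (f x - c)\<^sup>2)"
    using assms(1) by (intro sum_mono2) auto
  finally show ?thesis using assms by (simp add: field_simps)
qed

section \<open>Random subsets and increasing bijections\<close>

lemma card_subsets_containing:
  assumes "finite N" "S \<subseteq> N" "card S \<le> k"
  shows "card {A. A \<subseteq> N \<and> card A = k \<and> S \<subseteq> A} = (card N - card S) choose (k - card S)"
proof -
  have fS: "finite S" using assms finite_subset by blast
  have "{A. A \<subseteq> N \<and> card A = k \<and> S \<subseteq> A} = (\<lambda>B. B \<union> S) ` {B. B \<subseteq> N - S \<and> card B = k - card S}"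
  proof (intro subset_antisym subsetI)
    fix A assume A: "A \<in> {A. A \<subseteq> N \<and> card A = k \<and> S \<subseteq> A}"
    then have "A - S \<in> {B. B \<subseteq> N - S \<and> card B = k - card S}" "A = (A - S) \<union> S"
      using fS by (auto simp: card_Diff_subset)
    then show "A \<in> (\<lambda>B. B \<union> S) ` {B. B \<subseteq> N - S \<and> card B = k - card S}" by blast
  next
    fix A assume "A \<in> (\<lambda>B. B \<union> S) ` {B. B \<subseteq> N - S \<and> card B = k - card S}"
    then obtain B where B: "B \<subseteq> N - S" "card B = k - card S" "A = B \<union> S" by auto
    have "finite B" using B assms finite_subset[of B N] by auto
    then have "card A = card B + card S" using B fS by (simp add: card_Un_disjoint disjoint_iff subset_iff)
    then show "A \<in> {A. A \<subseteq> N \<and> card A = k \<and> S \<subseteq> A}" using B assms by auto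
  qed
  also have "card \<dots> = card {B. B \<subseteq> N - S \<and> card B = k - card S}"
    by (rule card_image) (auto simp: inj_on_def)
  also have "\<dots> = (card N - card S) choose (k - card S)"
    using assms fS by (subst n_subsets) (auto simp: card_Diff_subset)
  finally show ?thesis .
qed

text \<open>For a uniformly random \<open>k\<close>-subset the intersection with \<open>U\<close>
  has a hypergeometric size. Sampling without replacement correlates the indicators of distinct
  points negatively, so the variance is at most the mean, which is at most \<open>k\<close>.\<close>

lemma hypergeometric_variance:
  fixes k :: nat
  assumes N: "finite N" and U: "U \<subseteq> N" and k: "2 \<le> k" "k \<le> card N"
  shows "(\<Sum>A | A \<subseteq> N \<and> card A = k. (real (card (A \<inter> U)) - k * card U / card N)\<^sup>2)
     \<le> (card N choose k) * k"
proof -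
  define P where "P = {A. A \<subseteq> N \<and> card A = k}"
  define F where "F A = real (card (A \<inter> U))" for A
  define n where "n = real (card N)"
  define u where "u = real (card U)"
  define c where "c = real (card N choose k)"
  have fP: "finite P" unfolding P_def using N by simp
  have fU: "finite U" using N U finite_subset by blast
  have cP: "real (card P) = c" unfolding P_def c_def using n_subsets[OF N] by simp
  have F: "F A = (\<Sum>x\<in>U. of_bool (x \<in> A))" for A
    using fU by (simp add: F_def Int_commute)
  have n2: "n \<ge> 2" "n \<ge> k" using k by (auto simp: n_def)
  have un: "u \<le> n" "0 \<le> u" using U N by (auto simp: u_def n_def card_mono)
  \<comment> \<open>Absorption expresses both binomials through \<open>c\<close>: a given point is
    chosen with probability k / n, two given points with probability k (k - 1) / (n (n -
    1)).\<close>
  have b1: "n * ((card N - 1) choose (k - 1)) = k * c"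
    using binomial_absorption[of "k - 1" "card N"] k
    by (simp add: n_def c_def flip: of_nat_mult)
  have "(card N - 1) * ((card N - 2) choose (k - 2)) = (k - 1) * ((card N - 1) choose (k - 1))"
    using binomial_absorption[of "k - 2" "card N - 1"] k
    by (simp add: numeral_2_eq_2 Suc_diff_Suc)
  then have "real ((card N - 1) * ((card N - 2) choose (k - 2))) = real ((k - 1) * ((card N - 1) choose (k - 1)))"
    by (rule arg_cong)
  then have b2: "(n - 1) * ((card N - 2) choose (k - 2)) = (real k - 1) * ((card N - 1) choose (k - 1))"
    using k unfolding of_nat_mult by (simp add: n_def of_nat_diff)
  have S1: "(\<Sum>A\<in>P. F A) = u * ((card N - 1) choose (k - 1))"
  proof -
    have "(\<Sum>A\<in>P. F A) = (\<Sum>x\<in>U. \<Sum>A\<in>P. of_bool (x \<in> A))"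
      unfolding F by (rule sum.swap)
    also have "\<dots> = (\<Sum>x\<in>U. real ((card N - 1) choose (k - 1)))"
    proof (rule sum.cong[OF refl])
      fix x assume "x \<in> U"
      then have "card {A. A \<subseteq> N \<and> card A = k \<and> {x} \<subseteq> A} = (card N - 1) choose (k - 1)"
        using card_subsets_containing[of N "{x}" k] U N k by auto
      moreover have "P \<inter> {A. x \<in> A} = {A. A \<subseteq> N \<and> card A = k \<and> {x} \<subseteq> A}"
        by (auto simp: P_def)
      ultimately show "(\<Sum>A\<in>P. of_bool (x \<in> A)) = real ((card N - 1) choose (k - 1))"
        using fP by simp
    qed
    finally show ?thesis by (simp add: u_def)
  qed
  have S2: "(\<Sum>A\<in>P. (F A)\<^sup>2) = u * ((card N - 1) choose (k - 1)) + u * (u - 1) * ((card N - 2) choose (k - 2))"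
  proof -
    have "(\<Sum>A\<in>P. (F A)\<^sup>2) = (\<Sum>A\<in>P. \<Sum>x\<in>U. \<Sum>y\<in>U. of_bool (x \<in> A \<and> y \<in> A))"
      unfolding F power2_eq_square sum_product by (simp add: of_bool_conj)
    also have "\<dots> = (\<Sum>x\<in>U. \<Sum>y\<in>U. \<Sum>A\<in>P. of_bool (x \<in> A \<and> y \<in> A))"
      by (subst sum.swap) (intro sum.cong refl sum.swap)
    also have "\<dots> = (\<Sum>x\<in>U. \<Sum>y\<in>U. if x = y then real ((card N - 1) choose (k - 1)) else real ((card N - 2) choose (k - 2)))"
    proof (intro sum.cong refl)
      fix x y assume xy: "x \<in> U" "y \<in> U"
      have "card {x,y} \<le> k" using k by (cases "x = y") auto
      then have "card {A. A \<subseteq> N \<and> card A = k \<and> {x,y} \<subseteq> A} = (card N - card {x,y}) choose (k - card {x,y})"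
        using card_subsets_containing[of N "{x,y}" k] U N k xy by auto
      moreover have "P \<inter> {A. x \<in> A \<and> y \<in> A} = {A. A \<subseteq> N \<and> card A = k \<and> {x,y} \<subseteq> A}"
        by (auto simp: P_def)
      ultimately show "(\<Sum>A\<in>P. of_bool (x \<in> A \<and> y \<in> A))
          = (if x = y then real ((card N - 1) choose (k - 1)) else real ((card N - 2) choose (k - 2)))"
        using fP by (cases "x = y") (simp_all add: numeral_2_eq_2)
    qed
    also have "\<dots> = (\<Sum>x\<in>U. ((card N - 1) choose (k - 1)) + (u - 1) * ((card N - 2) choose (k - 2)))"
    proof (rule sum.cong[OF refl])
      fix x assume x: "x \<in> U"
      then have "card U \<ge> 1" using fU by (simp add: Suc_le_eq card_gt_0_iff) blast
      moreover have "(\<Sum>y\<in>U-{x}. if x = y then real ((card N - 1) choose (k - 1)) else real ((card N - 2) choose (k - 2)))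
        = (\<Sum>y\<in>U-{x}. real ((card N - 2) choose (k - 2)))"
        by (intro sum.cong) auto
      ultimately show "(\<Sum>y\<in>U. if x = y then real ((card N - 1) choose (k - 1)) else real ((card N - 2) choose (k - 2)))
        = ((card N - 1) choose (k - 1)) + (u - 1) * ((card N - 2) choose (k - 2))"
        using x fU by (subst sum.remove[OF fU x]) (simp_all add: u_def of_nat_diff)
    qed
    finally show ?thesis by (simp add: u_def algebra_simps)
  qed
  have c0: "0 \<le> c" by (simp add: c_def)
  have "real ((card N - 1) choose (k - 1)) = k * c / n" using b1 n2 by (simp add: field_simps)
  moreover from this have "real ((card N - 2) choose (k - 2)) = k * (real k - 1) * c / (n * (n - 1))"
  proof -
    have "real ((card N - 2) choose (k - 2)) = (real k - 1) * ((card N - 1) choose (k - 1)) / (n - 1)"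
      using b2 n2 by (simp add: eq_divide_eq mult.commute)
    then show ?thesis unfolding \<open>real ((card N - 1) choose (k - 1)) = k * c / n\<close> by (simp add: mult_ac)
  qed
  ultimately have "(\<Sum>A\<in>P. (F A - k * u / n)\<^sup>2)
     = u * (k * c / n) + u * (u - 1) * (k * (real k - 1) * c / (n * (n - 1))) - 2 * (k * u / n) * (u * (k * c / n)) + (k * u / n)\<^sup>2 * c"
    unfolding sum_square_diff S1 S2 cP by simp
  also have "\<dots> = u * k * c / n * (1 + (u - 1) * ((real k - 1) / (n - 1)) - u * k / n)"
    unfolding divide_inverse inverse_mult_distrib power2_eq_square by (simp add: algebra_simps)
  also have "\<dots> \<le> u * k * c / n * 1"
  proof (rule mult_left_mono)
    \<comment> \<open>This is the negative correlation; it uses \<open>k \<le> n\<close>.\<close>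
    have r: "(real k - 1) / (n - 1) \<le> k / n" using n2 by (simp add: field_simps)
    have "(u - 1) * ((real k - 1) / (n - 1)) \<le> u * ((real k - 1) / (n - 1))"
      using n2 k by (intro mult_right_mono) auto
    also have "\<dots> \<le> u * (k / n)" using r un by (intro mult_left_mono) auto
    finally show "1 + (u - 1) * ((real k - 1) / (n - 1)) - u * k / n \<le> 1" by simp
  qed (use un c0 n2 in auto)
  also have "\<dots> \<le> c * k"
    using un c0 n2 mult_right_mono[of u n "k * c"] by (simp add: field_simps)
  finally show ?thesis by (simp add: P_def F_def n_def u_def c_def)
qed

text \<open>The pointwise bound |g| <= g^2 / (2 sqrt k) + sqrt k / 2 reduces the first absolute
  moment to the variance; after the variance bound each term contributes half of
  \<open>sqrt k\<close>.\<close>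

lemma hypergeometric_abs_deviation:
  fixes k :: nat
  assumes N: "finite N" and U: "U \<subseteq> N" and k: "2 \<le> k" "k \<le> card N"
  shows "(\<Sum>A | A \<subseteq> N \<and> card A = k. \<bar>real (card (A \<inter> U)) - k * card U / card N\<bar>)
     \<le> (card N choose k) * sqrt k"
proof -
  define P where "P = {A. A \<subseteq> N \<and> card A = k}"
  define g where "g A = real (card (A \<inter> U)) - k * card U / card N" for A
  have cP: "real (card P) = (card N choose k)" unfolding P_def using n_subsets[OF N] by simp
  have s: "sqrt k > 0" using k by simp
  have "(\<Sum>A\<in>P. \<bar>g A\<bar>) \<le> (\<Sum>A\<in>P. (g A)\<^sup>2 / (2 * sqrt k) + sqrt k / 2)"
  proof (rule sum_mono)
    fix A
    have "0 \<le> (\<bar>g A\<bar> - sqrt k)\<^sup>2" by simp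
    then have "2 * (sqrt k * \<bar>g A\<bar>) \<le> (g A)\<^sup>2 + sqrt k * sqrt k"
      by (simp add: power2_diff mult_ac)
    then show "\<bar>g A\<bar> \<le> (g A)\<^sup>2 / (2 * sqrt k) + sqrt k / 2"
      using s by (simp add: field_simps del: real_sqrt_mult_self)
  qed
  also have "\<dots> = (\<Sum>A\<in>P. (g A)\<^sup>2) / (2 * sqrt k) + (card N choose k) * (sqrt k / 2)"
    by (simp add: sum.distrib cP sum_divide_distrib)
  also have "\<dots> \<le> ((card N choose k) * k) / (2 * sqrt k) + (card N choose k) * (sqrt k / 2)"
    using hypergeometric_variance[OF assms] s
    by (intro add_right_mono divide_right_mono) (auto simp: P_def g_def)
  also have "\<dots> = (card N choose k) * sqrt k"
    using s by (simp add: field_simps)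
  finally show ?thesis by (simp add: P_def g_def)
qed

section \<open>Increasing bijections between finite sets\<close>

text \<open>Both functions send the sorted list of \<open>A\<close> to the sorted list of the common
  image, and that list is unique. Hence \<open>A\<close> and \<open>B\<close> determine the planted
  values.\<close>

lemma strict_mono_on_same_image_eq:
  fixes f g :: "'a::linorder \<Rightarrow> 'b::linorder"
  assumes "finite A" "strict_mono_on A f" "strict_mono_on A g" "f ` A = g ` A" "x \<in> A"
  shows "f x = g x"
proof -
  let ?l = "sorted_list_of_set A"
  have *: "sorted (map h ?l) \<and> distinct (map h ?l)" if "strict_mono_on A h" for h :: "'a \<Rightarrow> 'b"
  proof -
    have "sorted (map h ?l)" unfolding sorted_map
      by (rule sorted_wrt_mono_rel[of _ "(\<le>)"])
        (use assms(1) strict_mono_on_leD[OF that] in auto)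
    then show ?thesis
      using assms(1) strict_mono_on_imp_inj_on[OF that] by (simp add: distinct_map)
  qed
  have "map f ?l = map g ?l"
    using *[OF assms(2)] *[OF assms(3)] assms(1,4)
    by (intro sorted_distinct_set_unique) auto
  then show ?thesis using assms by auto
qed

text \<open>Both sets are enumerated increasingly by the same initial segment of the naturals; the
  inverse of one enumeration is followed by the other.\<close>

lemma strict_mono_bijection_exists:
  fixes A :: "'a::wellorder set" and B :: "'b::wellorder set"
  assumes "finite A" "finite B" "card A = card B"
  obtains h where "strict_mono_on A h" "h ` A = B"
proof -
  obtain f where f: "bij_betw f {..<card A} A" "strict_mono_on {..<card A} f"
    using ex_bij_betw_strict_mono_card[OF assms(1)] by blast
  obtain g where g: "bij_betw g {..<card A} B" "strict_mono_on {..<card A} g"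
    using ex_bij_betw_strict_mono_card[OF assms(2)] assms(3) by metis
  define f' where "f' = inv_into {..<card A} f"
  have f': "f' x \<in> {..<card A}" "f (f' x) = x" if "x \<in> A" for x
    using that f(1) unfolding f'_def bij_betw_def by (metis inv_into_into, metis f_inv_into_f)
  have "f' x < f' y" if "x \<in> A" "y \<in> A" "x < y" for x y
    using that f'[of x] f'[of y] strict_mono_on_leD[OF f(2), of "f' y" "f' x"]
    by (metis leD leI)
  then have "strict_mono_on A (g \<circ> f')"
    using f'(1) g(2) by (auto simp: strict_mono_on_def)
  moreover have "f' ` A = {..<card A}"
    using f(1) unfolding f'_def by (metis bij_betw_def bij_betw_inv_into)
  then have "(g \<circ> f') ` A = B" using g(1) by (metis bij_betw_def image_comp)
  ultimately show ?thesis by (rule that)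
qed

text \<open>An increasing map carries points across \<open>x\<close> in one direction only. The
  number of crossings therefore depends on \<open>A\<close> and its image alone, not on the
  map.\<close>

lemma card_crossing_eq:
  fixes \<sigma> :: "nat \<Rightarrow> nat"
  assumes "finite A" "strict_mono_on A \<sigma>"
  shows "real (card {i\<in>A. (i < x) \<noteq> (\<sigma> i < x)}) = \<bar>real (card {i\<in>A. i < x}) - real (card {j\<in>\<sigma> ` A. j < x})\<bar>"
proof -
  define I J where "I = {i\<in>A. i < x}" and "J = {i\<in>A. \<sigma> i < x}"
  have fin: "finite I" "finite J" using assms by (auto simp: I_def J_def)
  have "{j\<in>\<sigma> ` A. j < x} = \<sigma> ` J" by (auto simp: J_def)
  moreover have "inj_on \<sigma> J"
    using strict_mono_on_imp_inj_on[OF assms(2)] by (rule inj_on_subset) (auto simp: J_def)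
  ultimately have cJ: "card {j\<in>\<sigma> ` A. j < x} = card J" by (simp add: card_image)
  \<comment> \<open>both are initial segments of \<open>A\<close>\<close>
  have "I \<subseteq> J \<or> J \<subseteq> I"
  proof (rule ccontr)
    assume "\<not> (I \<subseteq> J \<or> J \<subseteq> I)"
    then obtain a b where ab: "a \<in> I" "a \<notin> J" "b \<in> J" "b \<notin> I" by blast
    then have "a < b" "\<sigma> b < \<sigma> a" "a \<in> A" "b \<in> A" by (auto simp: I_def J_def)
    then show False using assms(2) by (meson order.asym strict_mono_onD)
  qed
  then show ?thesis
  proof
    assume le: "I \<subseteq> J"
    then have "{i\<in>A. (i < x) \<noteq> (\<sigma> i < x)} = J - I" by (auto simp: I_def J_def)
    then have "real (card {i\<in>A. (i < x) \<noteq> (\<sigma> i < x)}) = real (card J) - real (card I)"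
      using le fin by (simp add: card_Diff_subset card_mono of_nat_diff)
    then show ?thesis using cJ card_mono[OF fin(2) le] by (simp add: I_def)
  next
    assume le: "J \<subseteq> I"
    then have "{i\<in>A. (i < x) \<noteq> (\<sigma> i < x)} = I - J" by (auto simp: I_def J_def)
    then have "real (card {i\<in>A. (i < x) \<noteq> (\<sigma> i < x)}) = real (card I) - real (card J)"
      using le fin by (simp add: card_Diff_subset card_mono of_nat_diff)
    then show ?thesis using cJ card_mono[OF fin(1) le] by (simp add: I_def)
  qed
qed

section \<open>Diagonal blocks\<close>

text \<open>Blocks are the fibres of \<open>div w\<close>, so boundaries sit at multiples of
  \<open>w\<close>. Inside \<open>{1..n}\<close> the first block lacks 0 and the last may be cut
  short; only the upper bound \<open>w\<close> on block sizes is used.\<close>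

definition diag_pairs :: "nat \<Rightarrow> nat set \<Rightarrow> nat set \<Rightarrow> (nat \<times> nat) set" where
  "diag_pairs w S T = {(i, j). i \<in> S \<and> j \<in> T \<and> i div w = j div w}"

definition diag_count :: "nat \<Rightarrow> nat set \<Rightarrow> (nat \<Rightarrow> nat) \<Rightarrow> nat" where
  "diag_count w S \<sigma> = card {i\<in>S. i div w = \<sigma> i div w}"

lemma finite_diag_pairs: "finite S \<Longrightarrow> finite T \<Longrightarrow> finite (diag_pairs w S T)"
  by (rule finite_subset[of _ "S \<times> T"]) (auto simp: diag_pairs_def)

lemma card_same_block_le:
  fixes w :: nat
  assumes "w > 0"
  shows "card {j\<in>T. j div w = b} \<le> w"
proof -
  have "{j\<in>T. j div w = b} \<subseteq> {b * w..<b * w + w}"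
  proof
    fix j assume "j \<in> {j\<in>T. j div w = b}"
    then have "j = b * w + j mod w" "j mod w < w" using assms by auto
    then show "j \<in> {b * w..<b * w + w}" by (metis atLeastLessThan_iff le_add1 nat_add_left_cancel_less)
  qed
  from card_mono[OF _ this] show ?thesis by simp
qed

lemma card_diag_pairs_le:
  assumes "w > 0" "finite S" "finite T"
  shows "card (diag_pairs w S T) \<le> card S * w" "card (diag_pairs w S T) \<le> card T * w"
proof -
  have "diag_pairs w S T = (SIGMA i:S. {j\<in>T. j div w = i div w})"
    by (auto simp: diag_pairs_def)
  then have "card (diag_pairs w S T) = (\<Sum>i\<in>S. card {j\<in>T. j div w = i div w})"
    using assms by (simp add: card_SigmaI)
  also have "\<dots> \<le> (\<Sum>i\<in>S. w)" by (intro sum_mono card_same_block_le assms)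
  finally show "card (diag_pairs w S T) \<le> card S * w" by simp
  have "diag_pairs w S T = (\<lambda>(j, i). (i, j)) ` (SIGMA j:T. {i\<in>S. i div w = j div w})"
    by (auto simp: diag_pairs_def image_iff)
  then have "card (diag_pairs w S T) \<le> card (SIGMA j:T. {i\<in>S. i div w = j div w})"
    using assms by (simp only:) (intro card_image_le finite_SigmaI, auto)
  also have "\<dots> = (\<Sum>j\<in>T. card {i\<in>S. i div w = j div w})"
    using assms by (simp add: card_SigmaI)
  also have "\<dots> \<le> (\<Sum>j\<in>T. w)" by (intro sum_mono card_same_block_le assms)
  finally show "card (diag_pairs w S T) \<le> card T * w" by simp
qed

text \<open>Each deleted row or column contains at most \<open>w\<close> diagonal pairs. This
  controls how far planting lowers the mean contributed by the remaining points.\<close>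

lemma card_diag_pairs_Diff:
  assumes "w > 0" "finite N" "A \<subseteq> N" "B \<subseteq> N"
  shows "card (diag_pairs w N N) \<le> card (diag_pairs w (N - A) (N - B)) + card A * w + card B * w"
proof -
  have fin: "finite A" "finite B" using assms finite_subset by auto
  have "diag_pairs w N N \<subseteq> diag_pairs w (N - A) (N - B) \<union> diag_pairs w A N \<union> diag_pairs w N B"
    by (auto simp: diag_pairs_def)
  then have "card (diag_pairs w N N) \<le> card (diag_pairs w (N - A) (N - B) \<union> diag_pairs w A N \<union> diag_pairs w N B)"
    using assms fin by (intro card_mono) (auto simp: finite_diag_pairs)
  also have "\<dots> \<le> card (diag_pairs w (N - A) (N - B)) + card (diag_pairs w A N) + card (diag_pairs w N B)"
    by (meson add_le_mono card_Un_le le_refl le_trans)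
  also have "\<dots> \<le> card (diag_pairs w (N - A) (N - B)) + card A * w + card B * w"
    using assms fin by (intro add_mono card_diag_pairs_le order_refl) auto
  finally show ?thesis .
qed

text \<open>By \<open>card_crossing_eq\<close> the summand at \<open>j\<close> is the number of
  points that the increasing bijection from \<open>A\<close> to \<open>B\<close> moves across the
  boundary \<open>j * w\<close>. Written through \<open>A\<close> and \<open>B\<close> it can be
  averaged over pairs of subsets.\<close>

definition block_discrepancy :: "nat \<Rightarrow> nat \<Rightarrow> nat set \<Rightarrow> nat set \<Rightarrow> real" where
  "block_discrepancy n w A B =
     (\<Sum>j=1..n div w. \<bar>real (card (A \<inter> {i\<in>{1..n}. i < j * w})) - real (card (B \<inter> {i\<in>{1..n}. i < j * w}))\<bar>)"

text \<open>A point whose image lies in another block crosses at least one boundary, so a union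
  bound over the boundaries applies.\<close>

lemma off_diagonal_le_discrepancy:
  assumes w: "w > 0" and A: "A \<subseteq> {1..n}" "\<sigma> ` A \<subseteq> {1..n}" and mono: "strict_mono_on A \<sigma>"
  shows "real (card A) - diag_count w A \<sigma> \<le> block_discrepancy n w A (\<sigma> ` A)"
proof -
  have fA: "finite A" using finite_subset[OF A(1)] by simp
  have "{i\<in>A. i div w \<noteq> \<sigma> i div w} \<subseteq> (\<Union>j\<in>{1..n div w}. {i\<in>A. (i < j * w) \<noteq> (\<sigma> i < j * w)})"
  proof
    fix i assume i: "i \<in> {i\<in>A. i div w \<noteq> \<sigma> i div w}"
    \<comment> \<open>The crossed boundary is the left end of the later of the two blocks. As the
      block indices differ, the larger one is at least 1.\<close>
    let ?j = "max (i div w) (\<sigma> i div w)"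
    have "i \<le> n" "\<sigma> i \<le> n" using i A by auto
    then have "?j \<le> n div w" by (simp add: div_le_mono)
    moreover have "(i < ?j * w) \<noteq> (\<sigma> i < ?j * w)" "1 \<le> ?j"
      using i w by (auto simp flip: div_less_iff_less_mult simp: max_def)
    ultimately show "i \<in> (\<Union>j\<in>{1..n div w}. {i\<in>A. (i < j * w) \<noteq> (\<sigma> i < j * w)})"
      using i by (intro UN_I[of ?j]) auto
  qed
  then have "card {i\<in>A. i div w \<noteq> \<sigma> i div w} \<le> card (\<Union>j\<in>{1..n div w}. {i\<in>A. (i < j * w) \<noteq> (\<sigma> i < j * w)})"
    using fA by (intro card_mono) auto
  also have "\<dots> \<le> (\<Sum>j=1..n div w. card {i\<in>A. (i < j * w) \<noteq> (\<sigma> i < j * w)})"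
    by (rule card_UN_le) simp
  finally have "real (card {i\<in>A. i div w \<noteq> \<sigma> i div w})
    \<le> (\<Sum>j=1..n div w. real (card {i\<in>A. (i < j * w) \<noteq> (\<sigma> i < j * w)}))"
    by (simp flip: of_nat_sum)
  also have "\<dots> = block_discrepancy n w A (\<sigma> ` A)"
  proof -
    have "A \<inter> {i\<in>{1..n}. i < x} = {i\<in>A. i < x}" "\<sigma> ` A \<inter> {i\<in>{1..n}. i < x} = {j\<in>\<sigma> ` A. j < x}" for x
      using A by auto
    then show ?thesis unfolding block_discrepancy_def card_crossing_eq[OF fA mono] by simp
  qed
  finally have "real (card {i\<in>A. i div w \<noteq> \<sigma> i div w}) \<le> block_discrepancy n w A (\<sigma> ` A)" .
  moreover have "card A = diag_count w A \<sigma> + card {i\<in>A. i div w \<noteq> \<sigma> i div w}"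
    unfolding diag_count_def using fA
    by (subst card_Un_disjoint[symmetric]) (auto intro: arg_cong[where f=card])
  ultimately show ?thesis by simp
qed

text \<open>Every row has at most \<open>w\<close> diagonal pairs, so
  \<open>permutation_count_variance\<close> applies with \<open>d = w\<close>, and Chebyshev's
  inequality finishes.\<close>

lemma diag_count_uniform_tail:
  fixes a :: real
  assumes w: "w > 0" "w \<le> n" and n: "n \<ge> 2" and a: "a > 0"
  shows "real (card {\<sigma>. \<sigma> permutes {1..n} \<and> card (diag_pairs w {1..n} {1..n}) / n + a \<le> diag_count w {1..n} \<sigma>})
     \<le> fact n * (3 * real w / a\<^sup>2)"
proof -
  let ?N = "{1..n}"
  let ?D = "diag_pairs w ?N ?N"
  have X: "{i\<in>?N. (i, \<sigma> i) \<in> ?D} = {i\<in>?N. i div w = \<sigma> i div w}" if "\<sigma> permutes ?N" for \<sigma>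
    using permutes_in_image[OF that] by (auto simp: diag_pairs_def)
  have "real (card ?D) \<le> real (card ?N * w)"
    using card_diag_pairs_le(1)[OF w(1), of ?N ?N] by (intro of_nat_mono) simp
  then have var: "(\<Sum>\<rho> | \<rho> permutes ?N. (real (card {i\<in>?N. (i, \<rho> i) \<in> ?D}) - card ?D / card ?N)\<^sup>2)
     \<le> fact (card ?N) * (3 * real w)"
    using n w by (intro permutation_count_variance) (auto simp: diag_pairs_def)
  have "real (card {\<rho> \<in> {\<rho>. \<rho> permutes ?N}. a \<le> \<bar>real (card {i\<in>?N. (i, \<rho> i) \<in> ?D}) - card ?D / card ?N\<bar>})
      \<le> fact (card ?N) * (3 * real w) / a\<^sup>2"
    by (rule card_deviation_le[OF _ a var]) (simp add: finite_permutations)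
  moreover have "{\<sigma>. \<sigma> permutes {1..n} \<and> card ?D / n + a \<le> diag_count w {1..n} \<sigma>}
    \<subseteq> {\<rho> \<in> {\<rho>. \<rho> permutes ?N}. a \<le> \<bar>real (card {i\<in>?N. (i, \<rho> i) \<in> ?D}) - card ?D / card ?N\<bar>}"
    using X by (auto simp: diag_count_def)
  then have "card {\<sigma>. \<sigma> permutes {1..n} \<and> card ?D / n + a \<le> diag_count w {1..n} \<sigma>}
    \<le> card {\<rho> \<in> {\<rho>. \<rho> permutes ?N}. a \<le> \<bar>real (card {i\<in>?N. (i, \<rho> i) \<in> ?D}) - card ?D / card ?N\<bar>}"
    by (intro card_mono) (simp_all add: finite_permutations)
  ultimately show ?thesis by simp
qed

section \<open>Permutations planted on a fixed pair of subsets\<close>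

definition planted :: "nat \<Rightarrow> nat set \<Rightarrow> nat set \<Rightarrow> (nat \<Rightarrow> nat) set" where
  "planted n A B = {\<sigma>. \<sigma> permutes {1..n} \<and> strict_mono_on A \<sigma> \<and> \<sigma> ` A = B}"

lemma planted_nonempty:
  assumes "A \<subseteq> {1..n}" "B \<subseteq> {1..n}" "card A = card B"
  obtains \<tau> where "\<tau> \<in> planted n A B"
proof -
  have fin: "finite A" "finite B" using assms finite_subset by auto
  obtain h where h: "strict_mono_on A h" "h ` A = B"
    using strict_mono_bijection_exists[OF fin assms(3)] by blast
  obtain \<tau> where t: "\<tau> permutes {1..n}" "\<And>i. i \<in> A \<Longrightarrow> \<tau> i = h i"
    using permutes_extension_exists[of "{1..n}" A h] assms h strict_mono_on_imp_inj_on[OF h(1)] by auto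
  have "strict_mono_on A \<tau>" using h(1) t(2) by (simp add: strict_mono_on_def)
  moreover have "\<tau> ` A = B" using h(2) t(2) by (simp cong: image_cong)
  ultimately show ?thesis using t(1) that by (simp add: planted_def)
qed

text \<open>The increasing bijection from \<open>A\<close> onto \<open>B\<close> is unique, so the
  planted permutations are exactly the extensions of one partial map, that is, a coset.\<close>

lemma planted_eq_image:
  assumes "\<tau> \<in> planted n A B" "A \<subseteq> {1..n}"
  shows "planted n A B = (\<lambda>\<rho>. \<tau> \<circ> \<rho>) ` {\<rho>. \<rho> permutes {1..n} - A}"
proof -
  have fA: "finite A" using assms finite_subset by auto
  have t: "\<tau> permutes {1..n}" "strict_mono_on A \<tau>" "\<tau> ` A = B"
    using assms by (auto simp: planted_def)
  have "planted n A B = {\<sigma>. \<sigma> permutes {1..n} \<and> (\<forall>i\<in>A. \<sigma> i = \<tau> i)}"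
  proof (intro subset_antisym subsetI)
    fix \<sigma> assume "\<sigma> \<in> planted n A B"
    then show "\<sigma> \<in> {\<sigma>. \<sigma> permutes {1..n} \<and> (\<forall>i\<in>A. \<sigma> i = \<tau> i)}"
      using strict_mono_on_same_image_eq[OF fA _ t(2), of \<sigma>] t(3) by (auto simp: planted_def)
  next
    fix \<sigma> assume s: "\<sigma> \<in> {\<sigma>. \<sigma> permutes {1..n} \<and> (\<forall>i\<in>A. \<sigma> i = \<tau> i)}"
    then have "\<sigma> ` A = B" "strict_mono_on A \<sigma>" using t by (auto simp: strict_mono_on_def image_iff)
    then show "\<sigma> \<in> planted n A B" using s by (simp add: planted_def)
  qed
  then show ?thesis using permutes_agreeing_on[OF t(1) assms(2)] by simp
qed

lemma card_planted:
  assumes "A \<subseteq> {1..n}" "B \<subseteq> {1..n}" "card A = card B"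
  shows "card (planted n A B) = fact (n - card A)"
proof -
  obtain \<tau> where t: "\<tau> \<in> planted n A B" using planted_nonempty[OF assms] .
  then have "\<tau> permutes {1..n}" by (simp add: planted_def)
  then have "card (planted n A B) = card {\<rho>. \<rho> permutes {1..n} - A}"
    unfolding planted_eq_image[OF t assms(1)]
    by (intro card_image inj_on_compose_permutes)
  also have "\<dots> = fact (n - card A)"
    using assms finite_subset[OF assms(1)]
    by (subst card_permutations[OF refl]) (auto simp: card_Diff_subset)
  finally show ?thesis .
qed

text \<open>At least \<open>3 * k / 4\<close> planted points stay in their block. The rest is
  \<open>\<tau> \<circ> \<rho>\<close> with \<open>\<rho>\<close> uniform on the complement of
  \<open>A\<close>; its mean count is at most \<open>k / 8\<close> below the uniform mean, and its
  fluctuations obey \<open>permutation_count_variance\<close>.\<close>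

lemma diag_count_planted_tail:
  assumes AB: "A \<subseteq> {1..n}" "B \<subseteq> {1..n}" "card A = k" "card B = k"
    and k: "k \<ge> 1" "2 * k \<le> n" and w: "w > 0" "32 * w \<le> n"
    and good: "block_discrepancy n w A B \<le> k / 4"
  shows "real (card {\<sigma>\<in>planted n A B. diag_count w {1..n} \<sigma> < card (diag_pairs w {1..n} {1..n}) / n + k / 2})
     \<le> fact (n - k) * (192 * real w / (real k)\<^sup>2)"
proof -
  let ?N = "{1..n}"
  let ?\<mu> = "card (diag_pairs w ?N ?N) / n"
  define T where "T = ?N - A"
  have fin: "finite A" "finite B" "finite T" using AB finite_subset by (auto simp: T_def)
  have cT: "card T = n - k" using AB fin by (simp add: T_def card_Diff_subset)
  obtain \<tau> where t: "\<tau> \<in> planted n A B" using planted_nonempty[OF AB(1,2)] AB by auto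
  have tp: "\<tau> permutes ?N" "strict_mono_on A \<tau>" "\<tau> ` A = B"
    using t by (auto simp: planted_def)
  \<comment> \<open>Absorbing \<open>\<tau>\<close> into the pair set turns the count for
    \<open>\<tau> \<circ> \<rho>\<close> on \<open>T\<close> into a count for \<open>\<rho>\<close>
    alone.\<close>
  define D where "D = {(i, j). i \<in> T \<and> j \<in> T \<and> i div w = \<tau> j div w}"
  have tT: "\<tau> ` T = ?N - B"
    unfolding T_def using tp permutes_inj_on[OF tp(1)] permutes_image[OF tp(1)] AB
    by (subst inj_on_image_set_diff[of \<tau> UNIV]) auto
  have "(\<lambda>(i, j). (i, \<tau> j)) ` D = diag_pairs w T (?N - B)"
  proof (intro subset_antisym subsetI)
    fix e assume "e \<in> (\<lambda>(i, j). (i, \<tau> j)) ` D"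
    then show "e \<in> diag_pairs w T (?N - B)" using tT by (auto simp: D_def diag_pairs_def)
  next
    fix e assume e: "e \<in> diag_pairs w T (?N - B)"
    then obtain i j where ij: "e = (i, \<tau> j)" "i \<in> T" "j \<in> T" "i div w = \<tau> j div w"
      unfolding diag_pairs_def tT[symmetric] by auto
    then show "e \<in> (\<lambda>(i, j). (i, \<tau> j)) ` D" by (force simp: D_def)
  qed
  moreover have "inj_on (\<lambda>(i, j). (i, \<tau> j)) D"
    using permutes_inj[OF tp(1)] by (auto simp: inj_on_def inj_def)
  ultimately have cD: "card D = card (diag_pairs w T (?N - B))"
    by (metis card_image)
  have t2: "card T \<ge> 2" using cT k w by simp
  have tn: "real (card T) = real n - real k" using cT k by simp
  have "card D \<le> card T * w" unfolding cD by (intro card_diag_pairs_le w fin) simp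
  then have "real (card D) \<le> real (card T * w)" by (rule of_nat_mono)
  then have var: "(\<Sum>\<rho> | \<rho> permutes T. (real (card {i\<in>T. (i, \<rho> i) \<in> D}) - card D / card T)\<^sup>2)
     \<le> fact (card T) * (3 * real w)"
    using t2 fin w k by (intro permutation_count_variance) (auto simp: D_def cT)
  \<comment> \<open>Deleting \<open>A\<close> and \<open>B\<close> loses at most
    \<open>2 * k * w\<close> pairs. Since \<open>32 * w \<le> n\<close> and \<open>card T\<close> is
    at least \<open>n / 2\<close>, this is at most \<open>k / 8 * card T\<close>; dividing by
    \<open>card T\<close> instead of \<open>n\<close> only raises the mean.\<close>
  have mean: "?\<mu> - k / 8 \<le> card D / card T"
  proof -
    have "card (diag_pairs w ?N ?N) \<le> card D + k * w + k * w"
      using card_diag_pairs_Diff[OF w(1), of ?N A B] AB cD by (simp add: T_def)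
    then have "real (card (diag_pairs w ?N ?N)) \<le> real (card D + k * w + k * w)"
      by (rule of_nat_mono)
    then have m: "real (card (diag_pairs w ?N ?N)) \<le> card D + 2 * (real k * w)" by simp
    have "real (32 * w) \<le> real n" using w by (intro of_nat_mono)
    then have w32: "real w \<le> n / 32" by simp
    have nk: "real n / 2 \<le> real (card T)" "0 < real (card T)" using tn t2 k by auto
    have "2 * (real k * w) \<le> real k * (n / 16)" using w32 mult_left_mono[OF w32, of "2 * real k"] by simp
    also have "\<dots> \<le> real k / 8 * card T" using nk mult_left_mono[OF nk(1), of "real k / 8"] by simp
    finally have "real (card (diag_pairs w ?N ?N)) - real k / 8 * card T \<le> card D"
      using m by simp
    then have "(real (card (diag_pairs w ?N ?N)) - real k / 8 * card T) / card T \<le> card D / card T"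
      using nk by (intro divide_right_mono) auto
    then have "real (card (diag_pairs w ?N ?N)) / card T - real k / 8 \<le> card D / card T"
      using nk(2) by (simp add: diff_divide_distrib)
    moreover have "?\<mu> \<le> real (card (diag_pairs w ?N ?N)) / card T"
      using nk tn by (intro divide_left_mono) auto
    ultimately show ?thesis by linarith
  qed
  have split: "real (diag_count w ?N (\<tau> \<circ> \<rho>)) \<ge> 3 * k / 4 + real (card {i\<in>T. (i, \<rho> i) \<in> D})"
    if r: "\<rho> permutes T" for \<rho>
  proof -
    have "\<rho> i = i" if "i \<in> A" for i using permutes_not_in[OF r] that by (auto simp: T_def)
    moreover have "?N = A \<union> T" using AB(1) by (auto simp: T_def)
    ultimately have "{i\<in>?N. i div w = (\<tau> \<circ> \<rho>) i div w} = {i\<in>A. i div w = \<tau> i div w} \<union> {i\<in>T. (i, \<rho> i) \<in> D}"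
      using permutes_in_image[OF r] by (auto simp: D_def)
    moreover have "{i\<in>A. i div w = \<tau> i div w} \<inter> {i\<in>T. (i, \<rho> i) \<in> D} = {}" by (auto simp: T_def)
    ultimately have "diag_count w ?N (\<tau> \<circ> \<rho>) = diag_count w A \<tau> + card {i\<in>T. (i, \<rho> i) \<in> D}"
      unfolding diag_count_def using fin by (simp add: card_Un_disjoint)
    moreover have "real k - diag_count w A \<tau> \<le> k / 4"
      using off_diagonal_le_discrepancy[OF w(1) AB(1) _ tp(2)] tp(3) AB good by auto
    ultimately show ?thesis by simp
  qed
  have "{\<sigma>\<in>planted n A B. diag_count w ?N \<sigma> < ?\<mu> + k / 2}
    \<subseteq> (\<lambda>\<rho>. \<tau> \<circ> \<rho>) ` {\<rho> \<in> {\<rho>. \<rho> permutes T}. k / 8 \<le> \<bar>real (card {i\<in>T. (i, \<rho> i) \<in> D}) - card D / card T\<bar>}"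
  proof
    fix \<sigma> assume s: "\<sigma> \<in> {\<sigma>\<in>planted n A B. diag_count w ?N \<sigma> < ?\<mu> + k / 2}"
    then obtain \<rho> where r: "\<rho> permutes T" "\<sigma> = \<tau> \<circ> \<rho>"
      using planted_eq_image[OF t AB(1)] by (auto simp: T_def)
    \<comment> \<open>The margin left for fluctuations is 3/4 - 1/2 - 1/8 = 1/8 of
      \<open>k\<close>.\<close>
    have "k / 8 \<le> \<bar>real (card {i\<in>T. (i, \<rho> i) \<in> D}) - card D / card T\<bar>"
    proof -
      have "diag_count w ?N (\<tau> \<circ> \<rho>) < ?\<mu> + k / 2" using s r(2) by blast
      then show ?thesis using split[OF r(1)] mean by linarith
    qed
    then show "\<sigma> \<in> (\<lambda>\<rho>. \<tau> \<circ> \<rho>) ` {\<rho> \<in> {\<rho>. \<rho> permutes T}. k / 8 \<le> \<bar>real (card {i\<in>T. (i, \<rho> i) \<in> D}) - card D / card T\<bar>}"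
      using r by auto
  qed
  then have "card {\<sigma>\<in>planted n A B. diag_count w ?N \<sigma> < ?\<mu> + k / 2}
    \<le> card {\<rho> \<in> {\<rho>. \<rho> permutes T}. k / 8 \<le> \<bar>real (card {i\<in>T. (i, \<rho> i) \<in> D}) - card D / card T\<bar>}"
    by (rule surj_card_le[rotated]) (simp add: finite_permutations fin)
  then have "real (card {\<sigma>\<in>planted n A B. diag_count w ?N \<sigma> < ?\<mu> + k / 2})
    \<le> card {\<rho> \<in> {\<rho>. \<rho> permutes T}. k / 8 \<le> \<bar>real (card {i\<in>T. (i, \<rho> i) \<in> D}) - card D / card T\<bar>}"
    by (rule of_nat_mono)
  also have "\<dots> \<le> fact (card T) * (3 * real w) / (k / 8)\<^sup>2"
    by (rule card_deviation_le[OF _ _ var]) (use k fin in \<open>auto simp: finite_permutations\<close>)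
  \<comment> \<open>The constant is 192 = 3 * 8^2.\<close>
  also have "\<dots> = fact (n - k) * (192 * real w / (real k)\<^sup>2)"
    by (simp add: cT power_divide)
  finally show ?thesis .
qed

section \<open>The planted measure\<close>

definition ksubsets :: "nat \<Rightarrow> nat \<Rightarrow> nat set set" where
  "ksubsets n k = {A. A \<subseteq> {1..n} \<and> card A = k}"

lemma finite_ksubsets [simp]: "finite (ksubsets n k)"
  by (simp add: ksubsets_def)

lemma card_ksubsets: "card (ksubsets n k) = n choose k"
  using n_subsets[of "{1..n}" k] by (simp add: ksubsets_def)

text \<open>At each of the \<open>n div w\<close> boundaries the two counts are compared through
  their common mean; each deviates from it by at most \<open>sqrt k\<close> on average.\<close>

lemma sum_block_discrepancy_le:
  assumes k: "2 \<le> k" "k \<le> n"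
  shows "(\<Sum>(A, B)\<in>ksubsets n k \<times> ksubsets n k. block_discrepancy n w A B)
    \<le> 2 * (real (n choose k))\<^sup>2 * (n / w) * sqrt k"
proof -
  let ?K = "ksubsets n k"
  define c where "c = real (n choose k)"
  define U where "U j = {i\<in>{1..n}. i < j * w}" for j
  define g where "g j A = \<bar>real (card (A \<inter> U j)) - real (k * card (U j)) / n\<bar>" for j A
  have cK: "real (card ?K) = c" by (simp add: card_ksubsets c_def)
  have "U j \<subseteq> {1..n}" for j by (auto simp: U_def)
  then have g: "(\<Sum>A\<in>?K. g j A) \<le> c * sqrt k" for j
    using hypergeometric_abs_deviation[of "{1..n}" "U j" k] k
    by (simp add: ksubsets_def g_def c_def)
  have "(\<Sum>(A, B)\<in>?K \<times> ?K. block_discrepancy n w A B)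
     = (\<Sum>j=1..n div w. \<Sum>(A, B)\<in>?K \<times> ?K. \<bar>real (card (A \<inter> U j)) - real (card (B \<inter> U j))\<bar>)"
    unfolding block_discrepancy_def U_def case_prod_beta by (rule sum.swap)
  also have "\<dots> \<le> (\<Sum>j=1..n div w. 2 * c * (c * sqrt k))"
  proof (rule sum_mono)
    fix j
    have tri: "\<bar>real (card (A \<inter> U j)) - real (card (B \<inter> U j))\<bar> \<le> g j A + g j B" for A B
      unfolding g_def
      using abs_triangle_ineq4[of "real (card (A \<inter> U j)) - real (k * card (U j)) / n"
          "real (card (B \<inter> U j)) - real (k * card (U j)) / n"] by simp
    have "(\<Sum>(A, B)\<in>?K \<times> ?K. \<bar>real (card (A \<inter> U j)) - real (card (B \<inter> U j))\<bar>)
      \<le> (\<Sum>(A, B)\<in>?K \<times> ?K. g j A + g j B)"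
      by (rule sum_mono) (use tri in auto)
    also have "\<dots> = 2 * c * (\<Sum>A\<in>?K. g j A)"
      by (simp add: sum.cartesian_product[symmetric] sum.distrib cK sum_distrib_left[symmetric])
    also have "\<dots> \<le> 2 * c * (c * sqrt k)"
      using g by (intro mult_left_mono) (auto simp: c_def)
    finally show "(\<Sum>(A, B)\<in>?K \<times> ?K. \<bar>real (card (A \<inter> U j)) - real (card (B \<inter> U j))\<bar>) \<le> 2 * c * (c * sqrt k)" .
  qed
  also have "\<dots> = real (n div w) * (2 * c * (c * sqrt k))" by simp
  also have "\<dots> \<le> n / w * (2 * c * (c * sqrt k))"
    by (intro mult_right_mono of_nat_div_le_of_nat) (simp add: c_def)
  finally show ?thesis by (simp add: c_def power2_eq_square mult_ac)
qed

text \<open>Markov's inequality at the threshold \<open>k / 4\<close>.\<close>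

lemma card_large_discrepancy_le:
  assumes k: "2 \<le> k" "k \<le> n"
  shows "real (card {(A, B)\<in>ksubsets n k \<times> ksubsets n k. k / 4 < block_discrepancy n w A B})
    \<le> (real (n choose k))\<^sup>2 * (8 * real n / (w * sqrt k))"
proof -
  let ?K = "ksubsets n k \<times> ksubsets n k"
  let ?L = "{(A, B)\<in>?K. k / 4 < block_discrepancy n w A B}"
  have "real (card ?L) * (k / 4) = (\<Sum>p\<in>?L. k / 4)" by simp
  also have "\<dots> \<le> (\<Sum>(A, B)\<in>?L. block_discrepancy n w A B)"
    by (rule sum_mono) auto
  also have "\<dots> \<le> (\<Sum>(A, B)\<in>?K. block_discrepancy n w A B)"
    by (rule sum_mono2) (auto simp: block_discrepancy_def intro!: sum_nonneg)
  also have "\<dots> \<le> 2 * (real (n choose k))\<^sup>2 * (n / w) * sqrt k"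
    by (rule sum_block_discrepancy_le[OF k])
  finally have "real (card ?L) \<le> 2 * (real (n choose k))\<^sup>2 * (n / w) * sqrt k / (k / 4)"
    using k by (subst pos_le_divide_eq) auto
  also have "\<dots> = 8 * (real (n choose k))\<^sup>2 * (n / w) * (sqrt k / k)" by simp
  also have "sqrt k / k = 1 / sqrt k" by (simp add: sqrt_divide_self_eq inverse_eq_divide)
  finally show ?thesis by (simp add: mult_ac)
qed

text \<open>Positions replace the values used in \<open>Z\<close>, so \<open>Z n k \<sigma> = incr_count n k (inv \<sigma>)\<close>.\<close>

definition incr_count :: "nat \<Rightarrow> nat \<Rightarrow> (nat \<Rightarrow> nat) \<Rightarrow> nat" where
  "incr_count n k \<sigma> = card {A\<in>ksubsets n k. strict_mono_on A \<sigma>}"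

lemma finite_planted [simp]: "finite (planted n A B)"
  by (rule finite_subset[of _ "{\<sigma>. \<sigma> permutes {1..n}}"]) (auto simp: planted_def finite_permutations)

text \<open>Double counting: a permutation increasing on \<open>A\<close> belongs to
  \<open>planted n A B\<close> for exactly one \<open>B\<close>, the image of \<open>A\<close>. Thus
  weighting by \<open>incr_count\<close> is, up to normalisation, the planted measure, with
  \<open>f\<close> as test function.\<close>

lemma sum_incr_count:
  fixes f :: "(nat \<Rightarrow> nat) \<Rightarrow> real"
  shows "(\<Sum>\<sigma> | \<sigma> permutes {1..n}. real (incr_count n k \<sigma>) * f \<sigma>)
    = (\<Sum>(A, B)\<in>ksubsets n k \<times> ksubsets n k. \<Sum>\<sigma>\<in>planted n A B. f \<sigma>)"
proof -
  let ?P = "{\<sigma>. \<sigma> permutes {1..n}}"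
  let ?K = "ksubsets n k"
  have fP: "finite ?P" by (simp add: finite_permutations)
  have "(\<Sum>\<sigma>\<in>?P. incr_count n k \<sigma> * f \<sigma>) = (\<Sum>\<sigma>\<in>?P. \<Sum>A\<in>?K. if strict_mono_on A \<sigma> then f \<sigma> else 0)"
    by (simp add: incr_count_def sum.If_cases Int_def)
  also have "\<dots> = (\<Sum>A\<in>?K. \<Sum>\<sigma>\<in>?P. if strict_mono_on A \<sigma> then f \<sigma> else 0)"
    by (rule sum.swap)
  also have "\<dots> = (\<Sum>A\<in>?K. \<Sum>B\<in>?K. \<Sum>\<sigma>\<in>planted n A B. f \<sigma>)"
  proof (rule sum.cong[OF refl])
    fix A assume A: "A \<in> ?K"
    have "(\<lambda>\<sigma>. \<sigma> ` A) ` {\<sigma>\<in>?P. strict_mono_on A \<sigma>} \<subseteq> ?K"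
    proof safe
      fix \<sigma> assume s: "\<sigma> permutes {1..n}" "strict_mono_on A \<sigma>"
      have "\<sigma> ` A \<subseteq> {1..n}"
        using A permutes_image[OF s(1)] by (auto simp: ksubsets_def)
      then show "\<sigma> ` A \<in> ?K"
        using A card_image[OF strict_mono_on_imp_inj_on[OF s(2)]] by (auto simp: ksubsets_def)
    qed
    then have "(\<Sum>B\<in>?K. \<Sum>\<sigma>\<in>{\<sigma>\<in>{\<sigma>\<in>?P. strict_mono_on A \<sigma>}. \<sigma> ` A = B}. f \<sigma>) = (\<Sum>\<sigma>\<in>{\<sigma>\<in>?P. strict_mono_on A \<sigma>}. f \<sigma>)"
      using fP by (intro sum.group) auto
    moreover have "{\<sigma>\<in>{\<sigma>\<in>?P. strict_mono_on A \<sigma>}. \<sigma> ` A = B} = planted n A B" for B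
      by (auto simp: planted_def)
    moreover have "(\<Sum>\<sigma>\<in>?P. if strict_mono_on A \<sigma> then f \<sigma> else 0) = (\<Sum>\<sigma>\<in>{\<sigma>\<in>?P. strict_mono_on A \<sigma>}. f \<sigma>)"
      by (rule sum.inter_filter[OF fP, symmetric])
    ultimately show "(\<Sum>\<sigma>\<in>?P. if strict_mono_on A \<sigma> then f \<sigma> else 0) = (\<Sum>B\<in>?K. \<Sum>\<sigma>\<in>planted n A B. f \<sigma>)"
      by simp
  qed
  also have "\<dots> = (\<Sum>(A, B)\<in>?K \<times> ?K. \<Sum>\<sigma>\<in>planted n A B. f \<sigma>)"
    by (rule sum.cartesian_product)
  finally show ?thesis .
qed

lemma sum_incr_count_total:
  "(\<Sum>\<sigma> | \<sigma> permutes {1..n}. real (incr_count n k \<sigma>)) = (real (n choose k))\<^sup>2 * fact (n - k)"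
proof -
  have "(\<Sum>\<sigma> | \<sigma> permutes {1..n}. real (incr_count n k \<sigma>)) = (\<Sum>(A, B)\<in>ksubsets n k \<times> ksubsets n k. \<Sum>\<sigma>\<in>planted n A B. 1)"
    using sum_incr_count[of n k "\<lambda>_. 1"] by simp
  also have "\<dots> = (\<Sum>(A, B)\<in>ksubsets n k \<times> ksubsets n k. fact (n - k))"
    by (rule sum.cong) (auto simp: ksubsets_def card_planted)
  also have "\<dots> = (real (n choose k))\<^sup>2 * fact (n - k)"
    by (simp add: case_prod_beta card_cartesian_product card_ksubsets power2_eq_square)
  finally show ?thesis .
qed

text \<open>Pairs of large discrepancy are charged all their planted permutations and are rare by
  Markov's inequality, which gives the first term. All other pairs fall under the tail bound for
  fixed \<open>A\<close> and \<open>B\<close>, which gives the second.\<close>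

lemma planted_measure_diag_count_tail:
  assumes k: "k \<ge> 2" "2 * k \<le> n" and w: "w > 0" "32 * w \<le> n"
  shows "(\<Sum>\<sigma> | \<sigma> permutes {1..n} \<and> diag_count w {1..n} \<sigma> < card (diag_pairs w {1..n} {1..n}) / n + k / 2.
             real (incr_count n k \<sigma>))
     \<le> (real (n choose k))\<^sup>2 * fact (n - k) * (8 * real n / (w * sqrt k) + 192 * real w / (real k)\<^sup>2)"
proof -
  let ?K = "ksubsets n k \<times> ksubsets n k"
  let ?b = "\<lambda>\<sigma>. diag_count w {1..n} \<sigma> < card (diag_pairs w {1..n} {1..n}) / n + k / 2"
  let ?L = "{(A, B)\<in>?K. k / 4 < block_discrepancy n w A B}"
  define v where "v = 192 * real w / (real k)\<^sup>2"
  have "{\<sigma>. \<sigma> permutes {1..n} \<and> ?b \<sigma>} = {\<sigma>\<in>{\<sigma>. \<sigma> permutes {1..n}}. ?b \<sigma>}" by simp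
  then have "(\<Sum>\<sigma> | \<sigma> permutes {1..n} \<and> ?b \<sigma>. real (incr_count n k \<sigma>))
      = (\<Sum>\<sigma> | \<sigma> permutes {1..n}. if ?b \<sigma> then real (incr_count n k \<sigma>) else 0)"
    by (simp only: sum.inter_filter finite_permutations finite_atLeastAtMost)
  also have "\<dots> = (\<Sum>\<sigma> | \<sigma> permutes {1..n}. real (incr_count n k \<sigma>) * of_bool (?b \<sigma>))"
    by (intro sum.cong) auto
  also have "\<dots> = (\<Sum>(A, B)\<in>?K. \<Sum>\<sigma>\<in>planted n A B. of_bool (?b \<sigma>))"
    by (rule sum_incr_count)
  also have "\<dots> \<le> (\<Sum>p\<in>?K. fact (n - k) * of_bool (p \<in> ?L) + fact (n - k) * v)"
  proof (rule sum_mono)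
    fix p assume "p \<in> ?K"
    then obtain A B where p: "p = (A, B)" "A \<in> ksubsets n k" "B \<in> ksubsets n k" by auto
    have AB: "A \<subseteq> {1..n}" "B \<subseteq> {1..n}" "card A = k" "card B = k"
      using p by (auto simp: ksubsets_def)
    have v0: "0 \<le> v" by (simp add: v_def)
    have s: "(\<Sum>\<sigma>\<in>planted n A B. of_bool (?b \<sigma>)) = real (card {\<sigma>\<in>planted n A B. ?b \<sigma>})"
      by (simp add: Int_def)
    have "real (card {\<sigma>\<in>planted n A B. ?b \<sigma>}) \<le> fact (n - k) * of_bool (p \<in> ?L) + fact (n - k) * v"
    proof (cases "p \<in> ?L")
      case True
      have "card {\<sigma>\<in>planted n A B. ?b \<sigma>} \<le> card (planted n A B)"
        by (rule card_mono) auto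
      also have "\<dots> = fact (n - k)" using card_planted[OF AB(1,2)] AB by simp
      finally have "real (card {\<sigma>\<in>planted n A B. ?b \<sigma>}) \<le> real (fact (n - k))"
        by (rule of_nat_mono)
      also have "\<dots> \<le> fact (n - k) * of_bool (p \<in> ?L) + fact (n - k) * v"
        using True v0 by simp
      finally show ?thesis .
    next
      case False
      then have "block_discrepancy n w A B \<le> k / 4" using p by auto
      then have "real (card {\<sigma>\<in>planted n A B. ?b \<sigma>}) \<le> fact (n - k) * v"
        unfolding v_def using k w by (intro diag_count_planted_tail AB) auto
      then show ?thesis using False by (simp only: of_bool_eq)
    qed
    then show "(case p of (A, B) \<Rightarrow> \<Sum>\<sigma>\<in>planted n A B. of_bool (?b \<sigma>))
       \<le> fact (n - k) * of_bool (p \<in> ?L) + fact (n - k) * v"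
      unfolding p(1) prod.case s .
  qed
  also have "\<dots> = fact (n - k) * (card ?L + (real (n choose k))\<^sup>2 * v)"
  proof -
    have "?K \<inter> ?L = ?L" by auto
    then show ?thesis
      by (simp add: sum.distrib sum_distrib_left[symmetric] card_cartesian_product card_ksubsets
          power2_eq_square algebra_simps)
  qed
  also have "\<dots> \<le> fact (n - k) * ((real (n choose k))\<^sup>2 * (8 * real n / (w * sqrt k)) + (real (n choose k))\<^sup>2 * v)"
    using k by (intro mult_left_mono add_right_mono card_large_discrepancy_le) auto
  finally show ?thesis by (simp add: v_def algebra_simps)
qed

section \<open>Failure of the law of large numbers\<close>

text \<open>The event \<open>g\<close> is rare under counting but carries most of the mass of
  \<open>z\<close>. Where \<open>z\<close> is close to its mean, mass and counting measure are
  comparable, so points with \<open>z\<close> close to its mean are few both inside \<open>g\<close>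
  and outside it.\<close>

lemma density_far_from_one:
  fixes z :: "'a \<Rightarrow> real"
  assumes S: "finite S" "S \<noteq> {}" and z: "\<And>x. x \<in> S \<Longrightarrow> 0 \<le> z x" and W: "(\<Sum>x\<in>S. z x) = W" "W > 0"
    and tail: "(\<Sum>x | x \<in> S \<and> \<not> g x. z x) \<le> W / 4" and g: "real (card {x\<in>S. g x}) \<le> card S / 8"
  shows "real (card S) / 4 \<le> card {x\<in>S. 1/4 < \<bar>z x / (W / card S) - 1\<bar>}"
proof -
  define s where "s = real (card S)"
  define Y where "Y = {x\<in>S. \<bar>z x / (W / s) - 1\<bar> \<le> 1/4}"
  have s: "s > 0" using S by (simp add: s_def card_gt_0_iff)
  have Ws: "W / s > 0" using s W by simp
  have fY: "finite Y" using S by (simp add: Y_def)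
  have "real (card {x\<in>Y. \<not> g x}) * (3/4 * (W / s)) = (\<Sum>x | x \<in> Y \<and> \<not> g x. 3/4 * (W / s))" by simp
  also have "\<dots> \<le> (\<Sum>x | x \<in> Y \<and> \<not> g x. z x)"
  proof (rule sum_mono)
    fix x assume "x \<in> {x. x \<in> Y \<and> \<not> g x}"
    then have "\<bar>z x / (W / s) - 1\<bar> \<le> 1/4" by (simp only: Y_def mem_Collect_eq)
    then have "3/4 \<le> z x / (W / s)" by linarith
    then show "3/4 * (W / s) \<le> z x" using Ws by (simp only: pos_le_divide_eq)
  qed
  also have "\<dots> \<le> (\<Sum>x | x \<in> S \<and> \<not> g x. z x)"
    using S z by (intro sum_mono2) (auto simp: Y_def)
  also have "\<dots> \<le> s / 4 * (W / s)" using tail s by simp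
  finally have "real (card {x\<in>Y. \<not> g x}) * (3/4) * (W / s) \<le> s / 4 * (W / s)" by (simp only: mult.assoc)
  then have 1: "real (card {x\<in>Y. \<not> g x}) * (3/4) \<le> s / 4"
    using Ws by (rule mult_right_le_imp_le)
  have "Y = {x\<in>Y. g x} \<union> {x\<in>Y. \<not> g x}" by auto
  then have "card Y \<le> card {x\<in>Y. g x} + card {x\<in>Y. \<not> g x}" by (metis card_Un_le)
  also have "card {x\<in>Y. g x} \<le> card {x\<in>S. g x}"
    using S by (intro card_mono) (auto simp: Y_def)
  finally have "real (card Y) \<le> s / 8 + card {x\<in>Y. \<not> g x}" using g by (simp add: s_def)
  \<comment> \<open>Outside \<open>g\<close> there are at most s / 3 points of \<open>Y\<close>,
    inside at most s / 8, and 1/3 + 1/8 < 1/2.\<close>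
  then have Y: "real (card Y) \<le> s / 2" using 1 s by simp
  have "S = Y \<union> {x\<in>S. 1/4 < \<bar>z x / (W / s) - 1\<bar>}" by (auto simp: Y_def)
  then have "card S \<le> card Y + card {x\<in>S. 1/4 < \<bar>z x / (W / s) - 1\<bar>}" by (metis card_Un_le)
  then show ?thesis using Y s unfolding s_def by linarith
qed

text \<open>The separating event is that \<open>diag_count\<close> exceeds its uniform mean by at
  least \<open>k / 2\<close>. With 1536 = 8 * 192, \<open>w2\<close> bounds the planted variance
  term by 1/8, and also the uniform tail; \<open>w1\<close> does the same for the boundary
  term.\<close>

lemma incr_count_not_concentrated_small:
  assumes k: "k \<ge> 2" "2 * k \<le> n" and w: "w > 0" "32 * w \<le> n"
    and w1: "64 * real n \<le> w * sqrt k" and w2: "1536 * real w \<le> (real k)\<^sup>2"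
    and W: "W = (real (n choose k))\<^sup>2 * fact (n - k)"
  shows "fact n / 4 \<le> real (card {\<sigma>. \<sigma> permutes {1..n} \<and> 1/4 < \<bar>incr_count n k \<sigma> / (W / fact n) - 1\<bar>})"
proof -
  let ?S = "{\<sigma>. \<sigma> permutes {1..n}}"
  let ?m = "card (diag_pairs w {1..n} {1..n}) / n + k / 2"
  have cS: "card ?S = fact n" by (rule card_permutations) auto
  have k0: "real k > 0" "real w > 0" "sqrt k > 0" using k w by auto
  have "real (card {\<sigma>\<in>?S. ?m \<le> diag_count w {1..n} \<sigma>}) \<le> fact n * (3 * real w / (k / 2)\<^sup>2)"
    using diag_count_uniform_tail[of w n "k / 2"] k w by simp
  also have "3 * real w / (k / 2)\<^sup>2 \<le> 1 / 8" using w2 k0 by (simp add: field_simps)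
  finally have unif: "real (card {\<sigma>\<in>?S. ?m \<le> diag_count w {1..n} \<sigma>}) \<le> card ?S / 8"
    unfolding cS by simp
  have "8 * real n / (w * sqrt k) \<le> 1 / 8" using w1 k0 by (simp add: field_simps)
  moreover have "192 * real w / (real k)\<^sup>2 \<le> 1 / 8" using w2 k0 by (simp add: field_simps)
  ultimately have "W * (8 * real n / (w * sqrt k) + 192 * real w / (real k)\<^sup>2) \<le> W * (1 / 4)"
    by (intro mult_left_mono) (auto simp: W)
  then have "(\<Sum>\<sigma> | \<sigma> \<in> ?S \<and> \<not> ?m \<le> diag_count w {1..n} \<sigma>. real (incr_count n k \<sigma>)) \<le> W / 4"
    using planted_measure_diag_count_tail[OF k w] unfolding not_le mem_Collect_eq W by linarith
  then have "real (card ?S) / 4 \<le> card {\<sigma>\<in>?S. 1/4 < \<bar>incr_count n k \<sigma> / (W / card ?S) - 1\<bar>}"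
    using k by (intro density_far_from_one[OF _ _ _ _ _ _ unif])
      (auto simp: finite_permutations sum_incr_count_total W simp del: One_nat_def intro: permutes_id)
  then show ?thesis unfolding cS by simp
qed

text \<open>The inequality first holds at 10, and each further step multiplies the right side by
  more than 4.\<close>

lemma fact_ge_two_times_four_power:
  assumes "k \<ge> 10"
  shows "2 * 4 ^ k \<le> (fact k :: real)"
  using assms
proof (induction k rule: nat_induct_at_least)
  case base
  show ?case by (simp add: fact_numeral)
next
  case (Suc k)
  have "2 * 4 ^ Suc k \<le> 4 * (fact k :: real)" using Suc by simp
  also have "\<dots> \<le> real (Suc k) * fact k" using Suc by (intro mult_right_mono) auto
  finally show ?case by simp
qed

text \<open>First moment method: the mean is (n choose k) / k!, at most 4^k / k! and hence at most
  1/2, so at least half of the permutations have count 0. There the ratio is 0 whatever the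
  normaliser \<open>c\<close>, at distance 1 from 1.\<close>

lemma incr_count_not_concentrated_large:
  assumes k: "k \<ge> 10" "k \<le> n" "n < 2 * k"
  shows "fact n / 4 \<le> real (card {\<sigma>. \<sigma> permutes {1..n} \<and> 1/4 < \<bar>incr_count n k \<sigma> / c - 1\<bar>})"
proof -
  let ?S = "{\<sigma>. \<sigma> permutes {1..n}}"
  let ?p = "{\<sigma>\<in>?S. incr_count n k \<sigma> \<noteq> 0}"
  let ?far = "{\<sigma>. \<sigma> permutes {1..n} \<and> 1/4 < \<bar>incr_count n k \<sigma> / c - 1\<bar>}"
  have cS: "card ?S = fact n" by (rule card_permutations) auto
  have fS: "finite ?S" by (simp add: finite_permutations)
  have "real (card ?p) = (\<Sum>\<sigma>\<in>?p. 1)" by simp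
  also have "\<dots> \<le> (\<Sum>\<sigma>\<in>?p. real (incr_count n k \<sigma>))" by (rule sum_mono) auto
  also have "\<dots> \<le> (\<Sum>\<sigma>\<in>?S. real (incr_count n k \<sigma>))" using fS by (intro sum_mono2) auto
  also have "\<dots> = (real (n choose k))\<^sup>2 * fact (n - k)" by (rule sum_incr_count_total)
  also have "\<dots> = fact n * (real (n choose k) / fact k)"
    using k by (simp add: binomial_fact power2_eq_square)
  also have "\<dots> \<le> fact n * (1 / 2)"
  proof (rule mult_left_mono)
    have "n choose k \<le> 2 ^ n"
      using k member_le_sum[of k "{..n}" "\<lambda>k. n choose k"] by (simp add: choose_row_sum)
    then have "real (n choose k) \<le> real (2 ^ n)" by (rule of_nat_mono)
    also have "\<dots> \<le> 2 ^ (2 * k)" using k by (simp add: power_increasing)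
    also have "\<dots> = 4 ^ k" by (simp add: power_mult)
    finally show "real (n choose k) / fact k \<le> 1 / 2"
      using fact_ge_two_times_four_power[OF k(1)] by (simp add: divide_le_eq del: of_nat_le_numeral_power_cancel_iff)
  qed simp
  finally have p: "real (card ?p) \<le> fact n / 2" by simp
  have "\<sigma> \<in> ?far" if "\<sigma> permutes {1..n}" "incr_count n k \<sigma> = 0" for \<sigma>
    using that by simp
  then have "?S \<subseteq> ?p \<union> ?far" by blast
  then have "card ?S \<le> card (?p \<union> ?far)" using fS by (intro card_mono) auto
  also have "\<dots> \<le> card ?p + card ?far" by (rule card_Un_le)
  finally have "real (card ?S) \<le> real (card ?p + card ?far)" by (rule of_nat_mono)
  then have "fact n \<le> real (card ?p) + real (card ?far)" unfolding cS by simp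
  then show ?thesis using p fact_ge_zero[of n, where 'a=real] by linarith
qed

section \<open>Choice of the block width and the growth hypothesis\<close>

text \<open>The width is the least integer that meets the boundary constraint, and the other
  constraints are upper bounds on it. Rounding up costs at most \<open>n / sqrt k\<close>, as
  \<open>sqrt k \<le> n\<close>, so 64 becomes 65.\<close>

lemma block_width_exists:
  assumes k: "real k \<ge> 5000000" "2 * k \<le> n" and n: "100000 * real n \<le> (real k)\<^sup>2 * sqrt k"
  obtains w :: nat where "w > 0" "32 * w \<le> n" "64 * real n \<le> w * sqrt k" "1536 * real w \<le> (real k)\<^sup>2"
proof -
  \<comment> \<open>64 makes the boundary term \<open>8 * n / (w * sqrt k)\<close> of the planted tail at most \<open>1/8\<close>\<close>
  define w where "w = nat \<lceil>64 * real n / sqrt k\<rceil>"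
  \<comment> \<open>2080 = 32 * 65 is what \<open>32 * w \<le> n\<close> requires; its square is
    below 5000000.\<close>
  have "sqrt (2080\<^sup>2) \<le> sqrt k" using k by (intro real_sqrt_le_mono) simp
  then have s: "sqrt k \<ge> 2080" by simp
  then have "sqrt k * 1 \<le> sqrt k * sqrt k" by (intro mult_left_mono) linarith+
  then have sk: "sqrt k \<le> n" using k by simp
  have n0: "real n > 0" using k by simp
  have pos: "64 * real n / sqrt k > 0" using s n0 by (intro divide_pos_pos) linarith+
  have w1: "64 * real n / sqrt k \<le> w" unfolding w_def by (rule real_nat_ceiling_ge)
  have "real w < 64 * real n / sqrt k + 1" using pos unfolding w_def by linarith
  also have "1 \<le> real n / sqrt k" using sk s by (subst le_divide_eq_1_pos) linarith+
  finally have w2: "real w \<le> 65 * real n / sqrt k" by simp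
  show ?thesis
  proof
    show "w > 0" using w1 pos by linarith
    have "65 * real n / sqrt k \<le> 65 * real n / 2080" using s n0 by (intro divide_left_mono mult_pos_pos) linarith+
    then have "real (32 * w) \<le> real n" using w2 by simp
    then show "32 * w \<le> n" by (simp only: of_nat_le_iff)
    show "64 * real n \<le> w * sqrt k" using w1 s by (subst (asm) pos_divide_le_eq) linarith+
    \<comment> \<open>1536 * 65 = 99840, just below the 100000 of the hypothesis.\<close>
    have "1536 * (65 * real n) / sqrt k \<le> (real k)\<^sup>2"
      using n s n0 by (subst pos_divide_le_eq) linarith+
    then show "1536 * real w \<le> (real k)\<^sup>2" using w2 by linarith
  qed
qed

text \<open>In terms of \<open>y\<close> one has n = y^(9/4), which is at most y^(5/2) because
  \<open>y \<ge> 1\<close>, while \<open>k\<close> is at least 5000000 times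
  \<open>y\<close>.\<close>

lemma growth_condition:
  assumes n: "n \<ge> 1" and k: "5000000 < real k / real n powr (4/9)"
  shows "real k \<ge> 5000000" "100000 * real n \<le> (real k)\<^sup>2 * sqrt k"
proof -
  define y where "y = real n powr (4/9)"
  have y1: "y \<ge> 1" using n by (simp add: y_def ge_one_powr_ge_zero)
  have ky: "5000000 * y \<le> k" using k y1 by (simp add: y_def[symmetric] field_simps)
  then show "real k \<ge> 5000000" using y1 by linarith
  have yk: "y \<le> k" using ky y1 by linarith
  have "real n = y powr (9/4)" using n by (simp add: y_def powr_powr)
  also have "\<dots> \<le> y powr (2 + 1/2)" using y1 by (intro powr_mono) auto
  also have "\<dots> = y * (y * sqrt y)"
    using y1 by (subst powr_add) (simp add: powr_half_sqrt power2_eq_square)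
  finally have "100000 * real n \<le> (5000000 * y) * (y * sqrt y)" using y1 by simp
  also have "\<dots> \<le> k * (k * sqrt k)"
    using ky yk y1 by (intro mult_mono real_sqrt_le_mono) auto
  finally show "100000 * real n \<le> (real k)\<^sup>2 * sqrt k" by (simp add: power2_eq_square mult_ac)
qed

section \<open>Transfer to \<open>Z\<close> by inverting permutations\<close>

lemma Z_eq_incr_count: "Z n k \<sigma> = incr_count n k (inv \<sigma>)"
  unfolding Z_def incr_count_def ksubsets_def incr_subseq_def strict_mono_on_def
  by (rule arg_cong[where f=card]) auto

lemma expU_Z: "expU n (\<lambda>\<tau>. real (Z n k \<tau>)) = (real (n choose k))\<^sup>2 * fact (n - k) / fact n"
proof -
  have "(\<Sum>\<sigma> | \<sigma> permutes {1..n}. real (incr_count n k (inv \<sigma>))) = (\<Sum>\<sigma> | \<sigma> permutes {1..n}. real (incr_count n k \<sigma>))"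
    by (rule sum_permutations_inverse[symmetric])
  moreover have "card {\<sigma>. \<sigma> permutes {1..n}} = fact n" by (rule card_permutations) auto
  ultimately show ?thesis
    by (simp add: expU_def Sym_def Z_eq_incr_count sum_incr_count_total del: One_nat_def)
qed

text \<open>Inversion permutes the symmetric group, so \<open>Z\<close> and
  \<open>incr_count\<close> have the same distribution under the uniform measure.\<close>

lemma probU_Z:
  "probU n (\<lambda>\<sigma>. Q (Z n k \<sigma>)) = real (card {\<sigma>. \<sigma> permutes {1..n} \<and> Q (incr_count n k \<sigma>)}) / fact n"
proof -
  have "{\<sigma>. \<sigma> permutes {1..n} \<and> Q (incr_count n k \<sigma>)} = inv ` {\<sigma>\<in>Sym n. Q (Z n k \<sigma>)}"
  proof (intro subset_antisym subsetI)
    fix \<sigma> assume s: "\<sigma> \<in> {\<sigma>. \<sigma> permutes {1..n} \<and> Q (incr_count n k \<sigma>)}"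
    then have "inv (inv \<sigma>) = \<sigma>" "inv \<sigma> permutes {1..n}"
      by (auto intro: permutes_inv_inv permutes_inv)
    then show "\<sigma> \<in> inv ` {\<sigma>\<in>Sym n. Q (Z n k \<sigma>)}"
      using s by (intro image_eqI[of _ _ "inv \<sigma>"]) (auto simp: Sym_def Z_eq_incr_count)
  qed (auto simp: Sym_def Z_eq_incr_count permutes_inv)
  moreover have "inj_on inv {\<sigma>\<in>Sym n. Q (Z n k \<sigma>)}"
    by (rule inj_on_inverseI[of _ inv]) (auto simp: Sym_def permutes_inv_inv)
  moreover have "card {\<sigma>. \<sigma> permutes {1..n}} = fact n" by (rule card_permutations) auto
  ultimately show ?thesis by (simp add: probU_def card_image Sym_def)
qed

lemma Z_not_concentrated:
  assumes n: "n \<ge> 1" and k: "k \<le> n" "5000000 < real k / real n powr (4/9)"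
  shows "1/4 \<le> probU n (\<lambda>\<sigma>. \<bar>real (Z n k \<sigma>) / expU n (\<lambda>\<tau>. real (Z n k \<tau>)) - 1\<bar> > 1/4)"
proof -
  note gr = growth_condition[OF n k(2)]
  define W where "W = (real (n choose k))\<^sup>2 * fact (n - k)"
  have "fact n / 4 \<le> real (card {\<sigma>. \<sigma> permutes {1..n} \<and> 1/4 < \<bar>incr_count n k \<sigma> / (W / fact n) - 1\<bar>})"
  proof (cases "2 * k \<le> n")
    case True
    obtain w :: nat where "w > 0" "32 * w \<le> n" "64 * real n \<le> w * sqrt k" "1536 * real w \<le> (real k)\<^sup>2"
      using block_width_exists[OF gr(1) True gr(2)] by blast
    then show ?thesis
      using gr(1) by (intro incr_count_not_concentrated_small True W_def) auto
  next
    case False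
    then show ?thesis using gr(1) k by (intro incr_count_not_concentrated_large) auto
  qed
  then show ?thesis
    unfolding expU_Z W_def[symmetric]
      probU_Z[of n "\<lambda>z. \<bar>real z / (W / fact n) - 1\<bar> > 1/4" k]
    by (simp add: field_simps)
qed

theorem theorem1:
  fixes k :: "nat \<Rightarrow> nat"
  assumes "\<forall>n\<ge>1. 1 \<le> k n \<and> k n \<le> n"
    and "limsup (\<lambda>n. ereal (real (k n) / real n powr (4/9))) = \<infinity>"
  shows "\<not> (\<forall>\<epsilon>>0. (\<lambda>n. probU n (\<lambda>\<sigma>.
            \<bar>real (Z n (k n) \<sigma>) / expU n (\<lambda>\<tau>. real (Z n (k n) \<tau>)) - 1\<bar> > \<epsilon>))
          \<longlonglongrightarrow> 0)"
proof
  let ?p = "\<lambda>n. probU n (\<lambda>\<sigma>. \<bar>real (Z n (k n) \<sigma>) / expU n (\<lambda>\<tau>. real (Z n (k n) \<tau>)) - 1\<bar> > 1/4)"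
  assume "\<forall>\<epsilon>>0. (\<lambda>n. probU n (\<lambda>\<sigma>.
            \<bar>real (Z n (k n) \<sigma>) / expU n (\<lambda>\<tau>. real (Z n (k n) \<tau>)) - 1\<bar> > \<epsilon>)) \<longlonglongrightarrow> 0"
  from this[rule_format, of "1/4"] have "?p \<longlonglongrightarrow> 0" by simp
  then have "\<forall>\<^sub>F n in sequentially. ?p n < 1/4"
    by (rule order_tendstoD) simp
  \<comment> \<open>Contrapositive of \<open>Z_not_concentrated\<close>: a probability below 1/4
    forces the ratio to stay below the threshold, so its limsup is finite.\<close>
  then have "\<forall>\<^sub>F n in sequentially. ereal (real (k n) / real n powr (4/9)) \<le> ereal 5000000"
    using eventually_ge_at_top[of "1::nat"]
  proof eventually_elim
    case (elim n)
    then show ?case using Z_not_concentrated[of n "k n"] assms(1) by fastforce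
  qed
  then have "limsup (\<lambda>n. ereal (real (k n) / real n powr (4/9))) \<le> ereal 5000000"
    by (rule Limsup_bounded)
  then show False using assms(2) by simp
qed

end
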